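(* Let $A,B\in\mathbb{C}[X,Y]$ be coprime polynomials with $\deg A,\deg B\le k$, and let $D=A\,\partial_X+B\,\partial_Y$. Let $f/g\in\mathbb{C}(X,Y)\setminus\mathbb{C}$, with $f,g$ coprime, be an indecomposable rational function which is a first integral of $D$, i.e. $D(f/g)=0$. For a generic point $(x,y)\in\mathbb{C}^2$, let $N_D$ be the Newton polygon of the Laurent polynomial $x\,\frac{A(X,Y)}{X}+y\,\frac{B(X,Y)}{Y}$ and let $\mathcal{B}$ be the number of integer points in $N_D\cap\mathbb{N}^2$. Then $$\rho(f,g)<\mathcal{B}+2.$$
   Context: A rational function $h\in\mathbb{C}(X,Y)$ is a (rational) first integral of the derivation $D$ if $D(h)=0$. A rational function $f/g\in\mathbb{C}(X,Y)$ is decomposable if $f/g=u(h)$ with $u\in\mathbb{C}(T)$, $\deg u\ge2$ and $h\in\mathbb{C}(X,Y)$; otherwise it is indecomposable. For coprime $f,g$, $\deg(f/g)=\max\{\deg f,\deg g\}=:d$, and $f^h=Z^{d}f(X/Z,Y/Z)$, $g^h=Z^{d}g(X/Z,Y/Z)\in\mathbb{C}[X,Y,Z]$ are the homogenizations of $f,g$ to degree $d$. The spectrum is $\sigma(f,g)=\{(\lambda:\mu)\in\mathbb{P}^1(\mathbb{C}) : \lambda f^h-\mu g^h \text{ is reducible in } \mathbb{C}[X,Y,Z]\}$ (its elements are called remarkable values). For $(\lambda:\mu)\in\mathbb{P}^1(\mathbb{C})$, let $n(\lambda:\mu)$ be the number of distinct irreducible factors of $\lambda f^h-\mu g^h$ in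 $\mathbb{C}[X,Y,Z]$ (i.e. $\lambda f^h-\mu g^h=\prod_{i=1}^{n(\lambda:\mu)}(f^h_{(\lambda:\mu),i})^{e_{(\lambda:\mu),i}}$ with pairwise non-associate irreducible $f^h_{(\lambda:\mu),i}$). The total order of reducibility is $\rho(f,g)=\sum_{(\lambda:\mu)\in\sigma(f,g)}\big(n(\lambda:\mu)-1\big)$. The Newton polygon of a Laurent polynomial $\sum c_{\alpha,\beta}X^\alpha Y^\beta$ ($(\alpha,\beta)\in\mathbb{Z}^2$) is the convex hull in $\mathbb{R}^2$ of the exponents $(\alpha,\beta)$ with $c_{\alpha,\beta}\neq0$. $\mathbb{N}=\{0,1,2,\dots\}$. *)

theory Defs
  imports "HOL-Analysis.Analysis" "HOL-Computational_Algebra.Computational_Algebra"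
    "HOL-Computational_Algebra.Fraction_Field"
begin

text \<open>Bivariate polynomials C[X,Y] are represented as complex poly poly:
  the outer variable is Y, the inner variable is X. Trivariate polynomials
  C[X,Y,Z] are complex poly poly poly with X innermost, then Y, Z outermost.\<close>

type_synonym bipoly = "complex poly poly"
type_synonym tripoly = "complex poly poly poly"

definition cf :: "bipoly \<Rightarrow> nat \<Rightarrow> nat \<Rightarrow> complex" where
  "cf p i j = coeff (coeff p j) i"

definition cfi :: "bipoly \<Rightarrow> int \<Rightarrow> int \<Rightarrow> complex" where
  "cfi p i j = (if 0 \<le> i \<and> 0 \<le> j then cf p (nat i) (nat j) else 0)"

definition eval2 :: "bipoly \<Rightarrow> complex \<Rightarrow> complex \<Rightarrow> complex" where
  "eval2 p x y = poly (poly p [:y:]) x"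

definition tdeg :: "bipoly \<Rightarrow> nat" where
  "tdeg p = Max ({i + j | i j. cf p i j \<noteq> 0} \<union> {0})"

definition dX :: "bipoly \<Rightarrow> bipoly" where "dX p = map_poly pderiv p"
definition dY :: "bipoly \<Rightarrow> bipoly" where "dY p = pderiv p"

definition deriv2 :: "bipoly \<Rightarrow> bipoly \<Rightarrow> bipoly \<Rightarrow> bipoly" where
  "deriv2 A B p = A * dX p + B * dY p"

text \<open>f/g is a first integral of D: D(f/g) = (D(f) g - f D(g)) / g^2 = 0.\<close>
definition first_integral :: "bipoly \<Rightarrow> bipoly \<Rightarrow> bipoly \<Rightarrow> bipoly \<Rightarrow> bool" where
  "first_integral A B f g \<longleftrightarrow> g \<noteq> 0 \<and> deriv2 A B f * g - f * deriv2 A B g = 0"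

type_synonym ratfun = "bipoly fract"

definition rconst :: "complex \<Rightarrow> ratfun" where
  "rconst c = Fract [:[:c:]:] 1"

definition rcomp :: "complex poly \<Rightarrow> complex poly \<Rightarrow> ratfun \<Rightarrow> ratfun" where
  "rcomp p q h = poly (map_poly rconst p) h / poly (map_poly rconst q) h"

definition decomposable :: "bipoly \<Rightarrow> bipoly \<Rightarrow> bool" where
  "decomposable f g \<longleftrightarrow> (\<exists>p q h. coprime p q \<and> max (degree p) (degree q) \<ge> 2
       \<and> Fract f g = rcomp p q h)"

definition homog :: "nat \<Rightarrow> bipoly \<Rightarrow> tripoly" where
  "homog d p = (\<Sum>i\<le>d. \<Sum>j\<le>d. if i + j \<le> d
      then monom (monom (monom (cf p i j) i) j) (d - i - j) else 0)"

definition tconst :: "complex \<Rightarrow> tripoly" where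
  "tconst c = [:[:[:c:]:]:]"

definition pencil :: "bipoly \<Rightarrow> bipoly \<Rightarrow> complex \<Rightarrow> complex \<Rightarrow> tripoly" where
  "pencil f g l m = (let d = max (tdeg f) (tdeg g) in
      tconst l * homog d f - tconst m * homog d g)"

definition n_factors :: "tripoly \<Rightarrow> nat" where
  "n_factors F = card ({p. irreducible p \<and> p dvd F} // {(p, q). p dvd q \<and> q dvd p})"

text \<open>P^1(C), via the representatives (1:mu) and (0:1).\<close>
definition P1 :: "(complex \<times> complex) set" where
  "P1 = {(1, m) | m. True} \<union> {(0, 1)}"

definition spectrum2 :: "bipoly \<Rightarrow> bipoly \<Rightarrow> (complex \<times> complex) set" where
  "spectrum2 f g = {(l, m) \<in> P1. \<not> irreducible (pencil f g l m)}"

definition rho :: "bipoly \<Rightarrow> bipoly \<Rightarrow> nat" where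
  "rho f g = (\<Sum>(l, m)\<in>spectrum2 f g. n_factors (pencil f g l m) - 1)"

text \<open>Support of the Laurent polynomial x A/X + y B/Y: the coefficient of X^a Y^b
  is x * a_(a+1,b) + y * b_(a,b+1).\<close>
definition laurent_support :: "bipoly \<Rightarrow> bipoly \<Rightarrow> complex \<Rightarrow> complex \<Rightarrow> (int \<times> int) set" where
  "laurent_support A B x y =
     {(a, b). x * cfi A (a + 1) b + y * cfi B a (b + 1) \<noteq> 0}"

definition newton_polygon :: "(int \<times> int) set \<Rightarrow> (real \<times> real) set" where
  "newton_polygon S = convex hull ((\<lambda>(a, b). (real_of_int a, real_of_int b)) ` S)"

definition lattice_count :: "bipoly \<Rightarrow> bipoly \<Rightarrow> complex \<Rightarrow> complex \<Rightarrow> nat" where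
  "lattice_count A B x y =
     card {(a :: nat, b :: nat). (real a, real b) \<in> newton_polygon (laurent_support A B x y)}"

end

theory Submission
  imports Defs "HOL-Computational_Algebra.Field_as_Ring"
begin

text \<open>
  If the spectrum is infinite, \<^const>\<open>rho\<close> is a sum over an infinite set, hence \<open>0\<close>. Otherwise
  all but finitely many members of the pencil are irreducible; this finiteness replaces
  the indecomposability of \<open>f/g\<close> in the argument, so that no theorem of Lueroth or Bertini type
  is needed.

  Every irreducible factor \<open>P\<close> of a member of the pencil satisfies \<open>D P = L\<^sub>P P\<close>, and \<open>L\<^sub>P\<close> is supported on
  the lattice points of \<open>N\<^sub>D\<close>. Remove one pivot factor from each reducible member. The cofactors of
  the remaining factors are linearly independent: a relation \<open>\<Sum> c\<^sub>P L\<^sub>P = 0\<close> makes the closed form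
  \<open>\<omega> = \<Sum> c\<^sub>P dP/P\<close> vanish on \<open>D\<close>, so \<open>\<omega> = h dt\<close> with \<open>t = f/g\<close> and a first integral \<open>h\<close>. Then \<open>h\<close> is
  a rational function of \<open>t\<close>, so along a fixed fiber the order of \<open>h\<close> at a component is
  proportional to the multiplicity of the component. This contradicts that \<open>\<omega>\<close> has a simple pole
  at \<open>P\<close> when \<open>c\<^sub>P \<noteq> 0\<close>, but none at the pivot of the same fiber.

  The line at infinity is a further factor of at most one member, which accounts for the
  remaining \<open>1\<close> in the bound.
\<close>

section \<open>Supports and total degree\<close>

definition bconst :: "complex \<Rightarrow> bipoly" where
  "bconst c = [:[:c:]:]"

lemma bconst_0 [simp]: "bconst 0 = 0"
  and bconst_1 [simp]: "bconst 1 = 1"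
  by (simp_all add: bconst_def one_pCons)

lemma bconst_add: "bconst (a + b) = bconst a + bconst b"
  and bconst_diff: "bconst (a - b) = bconst a - bconst b"
  and bconst_minus: "bconst (- a) = - bconst a"
  and bconst_mult: "bconst (a * b) = bconst a * bconst b"
  by (simp_all add: bconst_def)

lemma bconst_eq_0_iff [simp]: "bconst c = 0 \<longleftrightarrow> c = 0"
  by (simp add: bconst_def)

lemma is_unit_bconst: "c \<noteq> 0 \<Longrightarrow> is_unit (bconst c)"
proof -
  assume "c \<noteq> 0"
  then have "bconst c * bconst (inverse c) = 1"
    unfolding bconst_mult[symmetric] by simp
  then show ?thesis by (metis dvdI)
qed

lemma is_unit_bipoly_iff: "is_unit (p :: bipoly) \<longleftrightarrow> (\<exists>c. c \<noteq> 0 \<and> p = bconst c)"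
proof
  assume "is_unit p"
  then obtain c where "p = bconst c"
    unfolding is_unit_poly_iff bconst_def by blast
  with \<open>is_unit p\<close> show "\<exists>c. c \<noteq> 0 \<and> p = bconst c"
    by (metis bconst_0 not_is_unit_0)
qed (use is_unit_bconst in blast)

lemma cf_0 [simp]: "cf 0 i j = 0"
  and cf_add: "cf (p + q) i j = cf p i j + cf q i j"
  and cf_diff: "cf (p - q) i j = cf p i j - cf q i j"
  by (simp_all add: cf_def)

lemma cf_sum: "cf (\<Sum>x\<in>S. f x) i j = (\<Sum>x\<in>S. cf (f x) i j)"
  by (simp add: cf_def coeff_sum)

lemma cf_bconst_mult [simp]: "cf (bconst c * p) i j = c * cf p i j"
  by (simp add: cf_def bconst_def)

lemma bipoly_eqI: "(\<And>i j. cf p i j = cf q i j) \<Longrightarrow> p = q"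
  by (auto simp: cf_def intro!: poly_eqI)

lemma bipoly_eq_0_iff: "p = 0 \<longleftrightarrow> (\<forall>i j. cf p i j = 0)"
  using bipoly_eqI[of p 0] by auto

lemma cf_mult:
  "cf (p * q) m n = (\<Sum>(j, i)\<in>{..n} \<times> {..m}. cf p i j * cf q (m - i) (n - j))"
  by (simp add: cf_def coeff_mult coeff_sum sum.cartesian_product)

lemma cf_mult_nonzeroE:
  assumes "cf (p * q) m n \<noteq> 0"
  obtains i j i' j' where "cf p i j \<noteq> 0" "cf q i' j' \<noteq> 0" "m = i + i'" "n = j + j'"
proof -
  obtain j i where *: "(j, i) \<in> {..n} \<times> {..m}" "cf p i j * cf q (m - i) (n - j) \<noteq> 0"
    using assms unfolding cf_mult by (metis (no_types, lifting) case_prod_conv sum.neutral surj_pair)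
  show thesis
    by (rule that[of i j "m - i" "n - j"]) (use * in auto)
qed

lemma finite_support: "finite {(i, j). cf p i j \<noteq> 0}"
proof -
  have "i \<le> degree (coeff p j) \<and> j \<le> degree p" if "cf p i j \<noteq> 0" for i j
    using that le_degree[of "coeff p j" i] le_degree[of p j] by (cases "coeff p j = 0") (auto simp: cf_def)
  then have "{(i, j). cf p i j \<noteq> 0} \<subseteq> (\<Union>j\<le>degree p. {..degree (coeff p j)} \<times> {j})"
    by blast
  then show ?thesis
    by (rule finite_subset) auto
qed

text \<open>A functional \<open>L\<close> may have many maximizers on a support. Maximizing
  \<open>L\<close>, then the first and then the second coordinate singles out one exponent.\<close>

lemma exists_lex_max:
  fixes L :: "nat \<Rightarrow> nat \<Rightarrow> real"
  assumes "finite S" "S \<noteq> {}"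
  obtains i j where "(i, j) \<in> S"
    "\<And>s t. (s, t) \<in> S \<Longrightarrow> L s t < L i j \<or> L s t = L i j \<and> (s < i \<or> s = i \<and> t \<le> j)"
proof -
  define M where "M = Max ((\<lambda>(s, t). L s t) ` S)"
  have le: "L s t \<le> M" if "(s, t) \<in> S" for s t
    unfolding M_def using assms that by (intro Max_ge) auto
  define S1 where "S1 = {(s, t) \<in> S. L s t = M}"
  have "M \<in> (\<lambda>(s, t). L s t) ` S"
    unfolding M_def using assms by (intro Max_in) auto
  then have S1: "finite S1" "S1 \<noteq> {}"
    using assms by (auto simp: S1_def intro: finite_subset[of _ S])
  define i where "i = Max (fst ` S1)"
  have i: "i \<in> fst ` S1" "\<And>s. s \<in> fst ` S1 \<Longrightarrow> s \<le> i"
    unfolding i_def using S1 by (auto intro: Max_in)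
  define T where "T = snd ` {x \<in> S1. fst x = i}"
  have T: "finite T" "T \<noteq> {}"
    using S1 i by (auto simp: T_def)
  define j where "j = Max T"
  have j: "j \<in> T" "\<And>t. t \<in> T \<Longrightarrow> t \<le> j"
    unfolding j_def using T by (auto intro: Max_in)
  have ij: "(i, j) \<in> S1"
    using j(1) by (auto simp: T_def)
  show thesis
  proof (rule that[of i j])
    show "(i, j) \<in> S" using ij by (auto simp: S1_def)
    fix s t assume st: "(s, t) \<in> S"
    show "L s t < L i j \<or> L s t = L i j \<and> (s < i \<or> s = i \<and> t \<le> j)"
    proof (cases "L s t = M")
      case True
      then have "(s, t) \<in> S1" using st by (auto simp: S1_def)
      moreover from this have "s \<le> i"
        using i(2)[of s] by force
      moreover have "t \<le> j" if "s = i"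
        using j(2)[of t] \<open>(s, t) \<in> S1\<close> that by (force simp: T_def)
      ultimately show ?thesis using ij True by (auto simp: S1_def)
    next
      case False
      then show ?thesis using le[OF st] ij by (auto simp: S1_def)
    qed
  qed
qed

text \<open>Ties between maximal exponents are broken lexicographically, so that the product of the two
  leading terms cannot cancel. This is the half of Ostrowski's theorem on Newton polygons
  of products that matters here.\<close>

lemma leading_term_mult:
  fixes u v :: real
  assumes "p \<noteq> 0" "q \<noteq> 0"
  obtains i j i' j' where "cf p i j \<noteq> 0" "cf q i' j' \<noteq> 0" "cf (p * q) (i + i') (j + j') \<noteq> 0"
    "\<And>s t. cf p s t \<noteq> 0 \<Longrightarrow> u * s + v * t \<le> u * i + v * j"
    "\<And>s t. cf q s t \<noteq> 0 \<Longrightarrow> u * s + v * t \<le> u * i' + v * j'"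
proof -
  define L where "L = (\<lambda>(s::nat) (t::nat). u * s + v * t)"
  have ne: "{(i, j). cf p i j \<noteq> 0} \<noteq> {}" "{(i, j). cf q i j \<noteq> 0} \<noteq> {}"
    using assms by (auto simp: bipoly_eq_0_iff)
  obtain i j where ij: "cf p i j \<noteq> 0"
    "\<And>s t. cf p s t \<noteq> 0 \<Longrightarrow> L s t < L i j \<or> L s t = L i j \<and> (s < i \<or> s = i \<and> t \<le> j)"
    using exists_lex_max[OF finite_support ne(1), of L] by auto
  obtain i' j' where ij': "cf q i' j' \<noteq> 0"
    "\<And>s t. cf q s t \<noteq> 0 \<Longrightarrow> L s t < L i' j' \<or> L s t = L i' j' \<and> (s < i' \<or> s = i' \<and> t \<le> j')"
    using exists_lex_max[OF finite_support ne(2), of L] by auto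
  have L_add: "L (a + a') (b + b') = L a b + L a' b'" for a a' b b'
    by (simp add: L_def algebra_simps)
  have zero: "cf p s t * cf q (i + i' - s) (j + j' - t) = 0"
    if "s \<le> i + i'" "t \<le> j + j'" "(t, s) \<noteq> (j, i)" for s t
  proof (rule ccontr)
    assume "\<not> ?thesis"
    then have nz: "cf p s t \<noteq> 0" "cf q (i + i' - s) (j + j' - t) \<noteq> 0" by auto
    \<comment> \<open>\<open>L\<close> is additive, so both exponents have maximal weight; the two
      lexicographic bounds then leave only (i, j) itself.\<close>
    have "L s t + L (i + i' - s) (j + j' - t) = L i j + L i' j'"
      using that by (simp flip: L_add)
    then show False
      using ij(2)[OF nz(1)] ij'(2)[OF nz(2)] that by auto
  qed
  have "cf (p * q) (i + i') (j + j') =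
      (\<Sum>(t, s)\<in>{(j, i)}. cf p s t * cf q (i + i' - s) (j + j' - t))"
    unfolding cf_mult
  proof (rule sum.mono_neutral_right)
    show "\<forall>x\<in>{..j + j'} \<times> {..i + i'} - {(j, i)}.
        (case x of (t, s) \<Rightarrow> cf p s t * cf q (i + i' - s) (j + j' - t)) = 0"
      using zero by fast
  qed auto
  then have "cf (p * q) (i + i') (j + j') \<noteq> 0"
    using ij(1) ij'(1) by simp
  moreover have "L s t \<le> L i j" if "cf p s t \<noteq> 0" for s t
    using ij(2)[OF that] by auto
  moreover have "L s t \<le> L i' j'" if "cf q s t \<noteq> 0" for s t
    using ij'(2)[OF that] by auto
  ultimately show thesis
    using that[of i j i' j'] ij(1) ij'(1) unfolding L_def by blast
qed

section \<open>Total degree and its additivity\<close>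

lemma finite_tdeg_set: "finite ({i + j | i j. cf p i j \<noteq> 0} \<union> {0})"
proof -
  have "{i + j | i j. cf p i j \<noteq> 0} = (\<lambda>(i, j). i + j) ` {(i, j). cf p i j \<noteq> 0}"
    by auto
  then show ?thesis using finite_support[of p] by simp
qed

lemma le_tdeg: "cf p i j \<noteq> 0 \<Longrightarrow> i + j \<le> tdeg p"
  unfolding tdeg_def by (rule Max_ge[OF finite_tdeg_set]) auto

lemma tdeg_leI: "(\<And>i j. cf p i j \<noteq> 0 \<Longrightarrow> i + j \<le> n) \<Longrightarrow> tdeg p \<le> n"
  unfolding tdeg_def using finite_tdeg_set[of p] by (subst Max_le_iff) auto

lemma tdeg_attained:
  assumes "p \<noteq> 0"
  obtains i j where "cf p i j \<noteq> 0" "i + j = tdeg p"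
proof -
  obtain a b where ab: "cf p a b \<noteq> 0"
    using assms by (auto simp: bipoly_eq_0_iff)
  have "tdeg p \<in> {i + j | i j. cf p i j \<noteq> 0} \<union> {0}"
    unfolding tdeg_def by (rule Max_in[OF finite_tdeg_set]) auto
  then show thesis
    using that ab le_tdeg[OF ab] by (cases "tdeg p = 0") auto
qed

lemma tdeg_0 [simp]: "tdeg 0 = 0"
  by (simp add: tdeg_def)

lemma tdeg_diff_le: "tdeg (p - q) \<le> max (tdeg p) (tdeg q)"
  by (rule tdeg_leI) (metis cf_diff diff_0 diff_zero le_max_iff_disj le_tdeg neg_equal_0_iff_equal)

lemma tdeg_bconst_mult_le: "tdeg (bconst c * p) \<le> tdeg p"
  by (rule tdeg_leI) (use le_tdeg in auto)

lemma tdeg_mult: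
  assumes "p \<noteq> 0" "q \<noteq> 0"
  shows "tdeg (p * q) = tdeg p + tdeg q"
proof (rule antisym)
  show "tdeg (p * q) \<le> tdeg p + tdeg q"
  proof (rule tdeg_leI)
    fix m n assume "cf (p * q) m n \<noteq> 0"
    then obtain i j i' j' where *: "cf p i j \<noteq> 0" "cf q i' j' \<noteq> 0" "m = i + i'" "n = j + j'"
      by (rule cf_mult_nonzeroE)
    then show "m + n \<le> tdeg p + tdeg q"
      using le_tdeg[of p i j] le_tdeg[of q i' j'] by simp
  qed
  \<comment> \<open>Weights u = v = 1 turn the functional into the total degree.\<close>
  obtain i j i' j' where *: "cf (p * q) (i + i') (j + j') \<noteq> 0"
    "\<And>s t. cf p s t \<noteq> 0 \<Longrightarrow> 1 * real s + 1 * real t \<le> 1 * real i + 1 * real j"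
    "\<And>s t. cf q s t \<noteq> 0 \<Longrightarrow> 1 * real s + 1 * real t \<le> 1 * real i' + 1 * real j'"
    by (rule leading_term_mult[OF assms, of 1 1]) blast
  obtain a b where ab: "cf p a b \<noteq> 0" "a + b = tdeg p" using tdeg_attained[OF assms(1)] .
  obtain a' b' where ab': "cf q a' b' \<noteq> 0" "a' + b' = tdeg q" using tdeg_attained[OF assms(2)] .
  show "tdeg p + tdeg q \<le> tdeg (p * q)"
    using *(2)[OF ab(1)] *(3)[OF ab'(1)] le_tdeg[OF *(1)] ab(2) ab'(2) by linarith
qed

lemma tdeg_eq_0_imp_bconst: "tdeg p = 0 \<Longrightarrow> p = bconst (cf p 0 0)"
proof (rule bipoly_eqI)
  fix i j assume "tdeg p = 0"
  then show "cf p i j = cf (bconst (cf p 0 0)) i j"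
    using le_tdeg[of p i j] by (cases i; cases j) (auto simp: bconst_def cf_def)
qed

lemma tdeg_bconst [simp]: "tdeg (bconst c) = 0"
proof -
  have "i + j \<le> 0" if "cf (bconst c) i j \<noteq> 0" for i j
    using that by (cases i; cases j) (auto simp: bconst_def cf_def)
  then show ?thesis
    using tdeg_leI[of "bconst c" 0] by blast
qed

lemma irreducible_tdeg_pos: "irreducible p \<Longrightarrow> tdeg p > 0"
  by (metis bconst_eq_0_iff irreducible_def is_unit_bconst neq0_conv tdeg_eq_0_imp_bconst)

section \<open>Derivations\<close>

lemma coeff_dX [simp]: "coeff (dX p) n = pderiv (coeff p n)"
  by (simp add: dX_def coeff_map_poly)

lemma cf_dX: "cf (dX p) i j = of_nat (Suc i) * cf p (Suc i) j"
  by (simp add: cf_def coeff_pderiv)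

lemma cf_dY: "cf (dY p) i j = of_nat (Suc j) * cf p i (Suc j)"
  by (simp add: cf_def dY_def coeff_pderiv of_nat_poly flip: of_nat_Suc)

lemma dX_add: "dX (p + q) = dX p + dX q"
  by (rule poly_eqI) (simp add: pderiv_add)

lemma dX_mult: "dX (p * q) = dX p * q + p * dX q"
proof (rule poly_eqI)
  fix n show "coeff (dX (p * q)) n = coeff (dX p * q + p * dX q) n"
    by (simp add: coeff_mult higher_pderiv_sum[of 1, simplified] pderiv_mult sum.distrib
        mult.commute[of _ "pderiv _"])
qed

lemma dX_bconst [simp]: "dX (bconst c) = 0"
  by (rule poly_eqI) (simp add: bconst_def coeff_pCons split: nat.splits)

lemma dY_add: "dY (p + q) = dY p + dY q"
  by (simp add: dY_def pderiv_add)

lemma dY_mult: "dY (p * q) = dY p * q + p * dY q"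
  by (simp add: dY_def pderiv_mult mult_ac)

lemma dY_bconst [simp]: "dY (bconst c) = 0"
  by (simp add: dY_def bconst_def pderiv_pCons)

lemma dX_dY: "dX (dY p) = dY (dX p)"
  by (rule bipoly_eqI) (simp add: cf_dX cf_dY)

lemma deriv2_add: "deriv2 A B (p + q) = deriv2 A B p + deriv2 A B q"
  by (simp add: deriv2_def dX_add dY_add algebra_simps)

lemma deriv2_mult: "deriv2 A B (p * q) = deriv2 A B p * q + p * deriv2 A B q"
  by (simp add: deriv2_def dX_mult dY_mult algebra_simps)

lemma deriv2_bconst [simp]: "deriv2 A B (bconst c) = 0"
  by (simp add: deriv2_def)

locale derivation =
  fixes d :: "bipoly \<Rightarrow> bipoly"
  assumes add: "d (p + q) = d p + d q"
    and mult: "d (p * q) = d p * q + p * d q"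
    and const [simp]: "d (bconst c) = 0"
begin

lemma zero [simp]: "d 0 = 0"
  using const[of 0] by simp

lemma one [simp]: "d 1 = 0"
  using const[of 1] by simp

lemma scale: "d (bconst c * p) = bconst c * d p"
  by (simp add: mult)

lemma minus: "d (- p) = - d p"
  using scale[of "- 1" p] by (simp add: bconst_minus)

lemma diff: "d (p - q) = d p - d q"
  using add[of p "- q"] by (simp add: minus)

lemma sum: "d (\<Sum>x\<in>S. f x) = (\<Sum>x\<in>S. d (f x))"
  by (induction S rule: infinite_finite_induct) (auto simp: add)

lemma power_Suc: "d (p ^ Suc n) = of_nat (Suc n) * p ^ n * d p"
  by (induction n) (auto simp: mult algebra_simps)

end

interpretation dX: derivation dX
  by unfold_locales (simp_all add: dX_add dX_mult)

interpretation dY: derivation dY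
  by unfold_locales (simp_all add: dY_add dY_mult)

interpretation deriv2: derivation "deriv2 A B" for A B
  by unfold_locales (simp_all add: deriv2_add deriv2_mult)

text \<open>In characteristic 0 a derivative has smaller degree in its variable, so divisibility by
  P forces it to vanish. If both partials vanish, P is constant.\<close>

lemma not_dvd_both_partials:
  assumes "irreducible P"
  shows "\<not> (P dvd dX P \<and> P dvd dY P)"
proof
  assume *: "P dvd dX P \<and> P dvd dY P"
  have "P \<noteq> 0" using assms by auto
  have "degree P = 0"
    using * by (simp add: dY_def)
  then obtain r where P: "P = [:r:]"
    by (auto elim: degree_eq_zeroE)
  have "dX P = [:pderiv r:]"
    by (rule poly_eqI) (simp add: P coeff_pCons split: nat.splits)
  then have "r dvd pderiv r"
    using * P by (simp add: const_poly_dvd_const_poly_iff)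
  then obtain c where "r = [:c:]"
    by (auto elim: degree_eq_zeroE)
  then have "P = bconst c" by (simp add: P bconst_def)
  then show False
    using assms irreducible_tdeg_pos[of P] by simp
qed

section \<open>Homogenization\<close>

lemma poly_eq_0_of_infinite_roots:
  fixes p :: "'a :: idom poly"
  assumes "infinite S" "\<And>x. x \<in> S \<Longrightarrow> poly p x = 0"
  shows "p = 0"
proof (rule ccontr)
  assume "p \<noteq> 0"
  then have "finite {x. poly p x = 0}" by (rule poly_roots_finite)
  moreover have "S \<subseteq> {x. poly p x = 0}" using assms(2) by blast
  ultimately show False using assms(1) finite_subset by blast
qed

lemma eval2_eqI:
  assumes "\<And>x y. eval2 p x y = eval2 q x y"
  shows "p = q"
proof -
  have "poly (p - q) [:y:] = 0" for y
    using assms by (subst poly_all_0_iff_0[symmetric]) (auto simp: eval2_def)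
  moreover have "infinite (range (\<lambda>y::complex. [:y:]))"
    by (subst finite_image_iff) (simp_all add: inj_on_def infinite_UNIV_char_0)
  ultimately have "p - q = 0"
    by (intro poly_eq_0_of_infinite_roots[of "range (\<lambda>y::complex. [:y:])"]) auto
  then show ?thesis by simp
qed

definition eval3 :: "tripoly \<Rightarrow> complex \<Rightarrow> complex \<Rightarrow> complex \<Rightarrow> complex" where
  "eval3 p x y z = eval2 (poly p (bconst z)) x y"

lemma eval2_mult: "eval2 (p * q) x y = eval2 p x y * eval2 q x y"
  by (simp add: eval2_def)

lemma eval3_mult: "eval3 (p * q) x y z = eval3 p x y z * eval3 q x y z"
  by (simp add: eval3_def eval2_mult)

lemma eval3_power: "eval3 (p ^ n) x y z = eval3 p x y z ^ n"
  by (simp add: eval3_def eval2_def)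

lemma eval3_sum: "eval3 (\<Sum>i\<in>S. f i) x y z = (\<Sum>i\<in>S. eval3 (f i) x y z)"
  by (simp add: eval3_def eval2_def poly_sum)

lemma eval3_monom: "eval3 (monom (monom (monom c i) j) k) x y z = c * x ^ i * y ^ j * z ^ k"
  by (simp add: eval3_def eval2_def bconst_def poly_monom flip: poly_const_pow)

lemma eval3_0 [simp]: "eval3 0 x y z = 0"
  by (simp add: eval3_def eval2_def)

lemma eval3_tconst [simp]: "eval3 (tconst c) x y z = c"
  by (simp add: eval3_def eval2_def tconst_def)

lemma eval3_const [simp]: "eval3 [:p:] x y z = eval2 p x y"
  by (simp add: eval3_def)

lemma eval3_Z [simp]: "eval3 [:0, 1:] x y z = z"
  by (simp add: eval3_def eval2_def bconst_def)

text \<open>Values off the plane z = 0 suffice, which permits division by z in the arguments on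
  homogenizations.\<close>

lemma eval3_eqI:
  assumes "\<And>x y z. z \<noteq> 0 \<Longrightarrow> eval3 p x y z = eval3 q x y z"
  shows "p = q"
proof -
  have "poly (p - q) (bconst z) = 0" if "z \<noteq> 0" for z
  proof -
    have "poly p (bconst z) = poly q (bconst z)"
      using assms[OF that] by (intro eval2_eqI) (auto simp: eval3_def)
    then show ?thesis by simp
  qed
  moreover have "infinite (bconst ` (- {0}))"
  proof -
    have "inj_on bconst (- {0})" by (auto simp: inj_on_def bconst_def)
    moreover have "infinite (- {0 :: complex})"
      using infinite_UNIV_char_0 by (metis Compl_eq_Diff_UNIV Diff_infinite_finite finite.emptyI finite.insertI)
    ultimately show ?thesis by (simp add: finite_image_iff)
  qed
  ultimately have "p - q = 0"
    by (intro poly_eq_0_of_infinite_roots[of "bconst ` (- {0})"]) auto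
  then show ?thesis by simp
qed

section \<open>Homogenization through evaluation\<close>

lemma bipoly_as_sum:
  assumes "tdeg p \<le> n"
  shows "p = (\<Sum>i\<le>n. \<Sum>j\<le>n. monom (monom (cf p i j) i) j)"
proof (rule bipoly_eqI)
  fix a b
  have *: "cf (monom (monom c i) j) a b = (if i = a then if j = b then c else 0 else 0)" for c i j
    by (auto simp: cf_def)
  have "cf (\<Sum>i\<le>n. \<Sum>j\<le>n. monom (monom (cf p i j) i) j) a b
      = (\<Sum>i\<le>n. if i = a then \<Sum>j\<le>n. if j = b then cf p i j else 0 else 0)"
    unfolding cf_sum * by (intro sum.cong refl) auto
  also have "\<dots> = cf p a b"
    using le_tdeg[of p a b] assms by (cases "cf p a b = 0") auto
  finally show "cf p a b = cf (\<Sum>i\<le>n. \<Sum>j\<le>n. monom (monom (cf p i j) i) j) a b" ..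
qed

lemma eval2_as_sum:
  assumes "tdeg p \<le> n"
  shows "eval2 p x y = (\<Sum>i\<le>n. \<Sum>j\<le>n. cf p i j * x ^ i * y ^ j)"
  by (subst bipoly_as_sum[OF assms])
    (simp add: eval2_def poly_sum poly_monom flip: poly_const_pow)

lemma eval3_homog:
  assumes "tdeg p \<le> d"
  shows "eval3 (homog d p) (x * z) (y * z) z = z ^ d * eval2 p x y"
proof -
  have "eval3 (if i + j \<le> d then monom (monom (monom (cf p i j) i) j) (d - i - j) else 0)
          (x * z) (y * z) z = z ^ d * (cf p i j * x ^ i * y ^ j)" for i j
  proof (cases "i + j \<le> d")
    case True
    then have "z ^ d = z ^ i * z ^ j * z ^ (d - i - j)"
      by (simp flip: power_add)
    with True show ?thesis
      by (simp add: eval3_monom power_mult_distrib mult_ac)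
  next
    case False
    then have "cf p i j = 0" using le_tdeg[of p i j] assms by fastforce
    then show ?thesis using False by simp
  qed
  then show ?thesis
    unfolding homog_def eval3_sum eval2_as_sum[OF assms] sum_distrib_left by simp
qed

lemma poly_homog_1:
  assumes "tdeg p \<le> d"
  shows "poly (homog d p) 1 = p"
proof (rule eval2_eqI)
  fix x y
  show "eval2 (poly (homog d p) 1) x y = eval2 p x y"
    using eval3_homog[OF assms, of x 1 y] by (simp add: eval3_def)
qed

text \<open>Every point with nonzero last coordinate has the form (xz, yz, z), so these values
  determine the homogenization.\<close>

lemma homog_eqI:
  assumes "tdeg p \<le> d" "\<And>x y z. z \<noteq> 0 \<Longrightarrow> eval3 P (x * z) (y * z) z = z ^ d * eval2 p x y"
  shows "homog d p = P"
proof (rule eval3_eqI)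
  fix x y z :: complex assume "z \<noteq> 0"
  then show "eval3 (homog d p) x y z = eval3 P x y z"
    using eval3_homog[OF assms(1), of "x / z" z "y / z"] assms(2)[of z "x / z" "y / z"] by simp
qed

lemma homog_mult:
  assumes "tdeg p \<le> a" "tdeg q \<le> b"
  shows "homog (a + b) (p * q) = homog a p * homog b q"
proof (rule homog_eqI)
  show "tdeg (p * q) \<le> a + b"
    using assms tdeg_mult[of p q] by (cases "p = 0 \<or> q = 0") auto
qed (use assms in \<open>simp add: eval3_mult eval3_homog eval2_mult power_add\<close>)

lemma homog_bconst: "homog n (bconst c) = tconst c * [:0, 1:] ^ n"
  by (rule homog_eqI) (simp_all add: eval3_mult eval3_power, simp add: eval2_def bconst_def)

lemma homog_add_degree:
  assumes "tdeg p \<le> d"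
  shows "homog (n + d) p = [:0, 1:] ^ n * homog d p"
  using homog_mult[of 1 n p d] assms homog_bconst[of n 1] tdeg_bconst[of 1]
  by (simp add: tconst_def flip: one_pCons)

lemma coeff_homog_0:
  assumes "tdeg p \<le> d"
  shows "cf (coeff (homog d p) 0) i j = (if i + j = d then cf p i j else 0)"
proof -
  have "cf (coeff (if a + b \<le> d then monom (monom (monom (cf p a b) a) b) (d - a - b) else 0) 0) i j
      = (if a = i then if b = j then if i + j = d then cf p i j else 0 else 0 else 0)" for a b
    by (auto simp: cf_def)
  then have "cf (coeff (homog d p) 0) i j
     = (\<Sum>a\<le>d. if a = i then \<Sum>b\<le>d. if b = j then if i + j = d then cf p i j else 0 else 0 else 0)"
    unfolding homog_def coeff_sum cf_sum by (intro sum.cong refl) auto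
  then show ?thesis by auto
qed

text \<open>Setting Z = 0 leaves the part of top degree, which is nonzero.\<close>

lemma Z_not_dvd_homog:
  assumes "p \<noteq> 0"
  shows "\<not> [:0, 1:] dvd homog (tdeg p) p"
proof
  assume "[:0, 1:] dvd homog (tdeg p) p"
  then obtain q where "homog (tdeg p) p = [:0, 1:] * q" ..
  then have "coeff (homog (tdeg p) p) 0 = 0" by simp
  moreover obtain i j where "cf p i j \<noteq> 0" "i + j = tdeg p"
    using tdeg_attained[OF assms] .
  ultimately show False
    using coeff_homog_0[of p "tdeg p" i j] by simp
qed

section \<open>Irreducibility of homogenizations\<close>

lemma is_unit_tripoly_iff: "is_unit (p :: tripoly) \<longleftrightarrow> (\<exists>c. c \<noteq> 0 \<and> p = tconst c)"
  unfolding is_unit_poly_iff[of p] is_unit_bipoly_iff by (auto simp: tconst_def bconst_def)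

text \<open>The substitution \<open>X \<mapsto> XZ, Y \<mapsto> YZ\<close> is an injective endomorphism that turns
  the homogenization of \<open>f\<close> into \<open>Z ^ d * f\<close>, whose factorization is visible.\<close>

definition scale_subst :: "tripoly \<Rightarrow> tripoly" where
  "scale_subst a = poly (map_poly (\<lambda>q. poly (map_poly (\<lambda>r. poly (map_poly tconst r)
     ([:[:[:0, 1:]:]:] * [:0, 1:])) q) ([:[:0, 1:]:] * [:0, 1:])) a) [:0, 1:]"

lemma eval3_scale_subst [simp]: "eval3 (scale_subst a) x y z = eval3 a (x * z) (y * z) z"
proof -
  have add: "eval3 (p + q) x y z = eval3 p x y z + eval3 q x y z" for p q
    by (simp add: eval3_def eval2_def)
  have X: "eval3 ([:[:[:0, 1:]:]:] * [:0, 1:]) x y z = x * z"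
    unfolding eval3_mult eval3_const eval3_Z by (simp add: eval2_def)
  have Y: "eval3 ([:[:0, 1:]:] * [:0, 1:]) x y z = y * z"
    unfolding eval3_mult eval3_const eval3_Z by (simp add: eval2_def)
  have [simp]: "tconst 0 = 0" by (simp add: tconst_def)
  have 1: "eval3 (poly (map_poly tconst r) ([:[:[:0, 1:]:]:] * [:0, 1:])) x y z = poly r (x * z)" for r
    by (induction r) (auto simp: map_poly_pCons add eval3_mult[of _ "poly _ _"] X simp del: mult_pCons_left mult_pCons_right)
  have 2: "eval3 (poly (map_poly (\<lambda>r. poly (map_poly tconst r) ([:[:[:0, 1:]:]:] * [:0, 1:])) q)
      ([:[:0, 1:]:] * [:0, 1:])) x y z = poly (poly q [:y * z:]) (x * z)" for q
    by (induction q) (auto simp: map_poly_pCons add eval3_mult[of _ "poly _ _"] Y 1 simp del: mult_pCons_left mult_pCons_right)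
  have "eval3 (scale_subst a) x y z = poly (poly (poly a (bconst z)) [:y * z:]) (x * z)"
    unfolding scale_subst_def
    by (induction a) (auto simp: map_poly_pCons add eval3_mult[of _ "poly _ _"] 2 bconst_def simp del: mult_pCons_left mult_pCons_right)
  then show ?thesis by (simp add: eval3_def eval2_def)
qed

lemma scale_subst_mult: "scale_subst (a * b) = scale_subst a * scale_subst b"
  by (rule eval3_eqI) (simp add: eval3_mult)

lemma scale_subst_inj:
  assumes "scale_subst a = scale_subst b"
  shows "a = b"
proof (rule eval3_eqI)
  fix x y z :: complex assume "z \<noteq> 0"
  then show "eval3 a x y z = eval3 b x y z"
    using arg_cong[OF assms, of "\<lambda>p. eval3 p (x / z) (y / z) z"] by simp
qed

lemma prime_elem_Z: "prime_elem ([:0, 1:] :: tripoly)"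
proof (rule prime_elemI)
  have Z_dvd: "[:0, 1:] dvd p \<longleftrightarrow> poly p 0 = 0" for p :: tripoly
    using dvd_iff_poly_eq_0[of 0 p] by simp
  show "\<not> ([:0, 1:] :: tripoly) dvd 1" by (simp add: Z_dvd)
  fix a b :: tripoly assume "[:0, 1:] dvd a * b"
  then show "[:0, 1:] dvd a \<or> [:0, 1:] dvd b" unfolding Z_dvd by simp
qed simp

text \<open>If the image of b absorbs f, the image of a divides a power of Z, hence is a constant
  times \<open>Z ^ k\<close>. The substitution fixes such monomials and is injective, so a is this
  monomial. As Z does not divide the homogenization, k = 0.\<close>

lemma is_unit_factor_of_homog:
  assumes "irreducible f" "homog (tdeg f) f = a * b" "[:f:] dvd scale_subst b"
  shows "is_unit a"
proof -
  have "f \<noteq> 0" using assms(1) by auto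
  have "scale_subst a * scale_subst b = [:f:] * [:0, 1:] ^ tdeg f"
    unfolding scale_subst_mult[symmetric] assms(2)[symmetric]
    by (rule eval3_eqI) (simp add: eval3_homog eval3_mult[of "[:f:]"] eval3_power del: mult_pCons_left)
  moreover obtain c where c: "scale_subst b = [:f:] * c"
    using assms(3) ..
  ultimately have "[:f:] * (scale_subst a * c) = [:f:] * [:0, 1:] ^ tdeg f"
    by (simp only: mult_ac)
  moreover have "[:f:] \<noteq> 0" using \<open>f \<noteq> 0\<close> by simp
  ultimately have "scale_subst a * c = [:0, 1:] ^ tdeg f"
    by (metis mult_left_cancel)
  then have "scale_subst a dvd [:0, 1:] ^ tdeg f" by (metis dvd_triv_left)
  then have "scale_subst a dvd normalize [:0, 1:] ^ tdeg f"
    by (simp only: normalize_power[symmetric] dvd_normalize_iff)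
  moreover have "prime (normalize ([:0, 1:] :: tripoly))"
    by (simp only: prime_normalize_iff prime_elem_Z)
  ultimately obtain k where "normalize (scale_subst a) = normalize (normalize [:0, 1:] ^ k)"
    using divides_primepow_weak by blast
  then have "normalize (scale_subst a) = normalize ([:0, 1:] ^ k)"
    by (simp only: normalize_power normalize_idem)
  then obtain u where "scale_subst a = u * [:0, 1:] ^ k" "is_unit u"
    by (metis associatedE1 mult.commute)
  then obtain t where t: "t \<noteq> 0" "scale_subst a = tconst t * [:0, 1:] ^ k"
    by (auto simp: is_unit_tripoly_iff)
  have "scale_subst (tconst t * [:0, 1:] ^ k) = tconst t * [:0, 1:] ^ k"
    by (rule eval3_eqI) (simp only: eval3_scale_subst eval3_mult eval3_power eval3_Z eval3_tconst)
  then have a: "a = tconst t * [:0, 1:] ^ k"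
    using t(2) scale_subst_inj by metis
  have "k = 0"
  proof (rule ccontr)
    assume "k \<noteq> 0"
    then have "[:0, 1:] dvd a" unfolding a by (intro dvd_mult dvd_power) simp
    then show False
      using assms(2) Z_not_dvd_homog[OF \<open>f \<noteq> 0\<close>] by simp
  qed
  then show ?thesis using a t(1) by (auto simp: is_unit_tripoly_iff)
qed

lemma is_unit_poly_1: "is_unit p \<Longrightarrow> is_unit (poly p 1)"
  by (metis dvd_def poly_1 poly_mult)

text \<open>The substitution turns a * b into \<open>f * Z ^ tdeg f\<close>. Since f stays prime in
  C[X,Y][Z], it divides one of the two images, and the other factor is then a unit.\<close>

lemma irreducible_homog:
  assumes "irreducible f"
  shows "irreducible (homog (tdeg f) f)"
proof (rule irreducibleI)
  have 1: "poly (homog (tdeg f) f) 1 = f" by (rule poly_homog_1) simp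
  show "homog (tdeg f) f \<noteq> 0" using 1 assms by auto
  show "\<not> is_unit (homog (tdeg f) f)"
    using 1 assms is_unit_poly_1 by (metis irreducible_not_unit)
  fix a b assume ab: "homog (tdeg f) f = a * b"
  have "prime_elem [:f:]"
    using assms by (simp add: irreducible_imp_prime_elem lift_prime_elem_poly)
  moreover have "[:f:] dvd scale_subst a * scale_subst b"
  proof -
    have "scale_subst a * scale_subst b = [:f:] * [:0, 1:] ^ tdeg f"
      unfolding scale_subst_mult[symmetric] ab[symmetric]
      by (rule eval3_eqI) (simp add: eval3_homog eval3_mult[of "[:f:]"] eval3_power del: mult_pCons_left)
    then show ?thesis by (metis dvd_triv_left)
  qed
  ultimately have "[:f:] dvd scale_subst a \<or> [:f:] dvd scale_subst b"
    by (simp only: prime_elem_dvd_mult_iff)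
  then show "is_unit a \<or> is_unit b"
    using is_unit_factor_of_homog[OF assms, of a b] is_unit_factor_of_homog[OF assms, of b a] ab
    by (auto simp: mult.commute)
qed

text \<open>A factorization of f homogenizes, with the surplus degree given to a; setting Z = 1
  takes units back to units. Positive degree excludes constants, whose homogenization to degree 1
  can be irreducible.\<close>

lemma irreducible_of_irreducible_homog:
  assumes "irreducible (homog d f)" "tdeg f \<le> d" "tdeg f > 0"
  shows "irreducible f"
proof (rule irreducibleI)
  show "f \<noteq> 0" using assms(3) by auto
  show "\<not> is_unit f" using assms(3) by (auto simp: is_unit_bipoly_iff)
  fix a b assume ab: "f = a * b"
  then have "tdeg f = tdeg a + tdeg b"
    using \<open>f \<noteq> 0\<close> by (auto simp: tdeg_mult)
  then have *: "tdeg a \<le> d - tdeg b" "d = (d - tdeg b) + tdeg b"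
    using assms(2) by auto
  have "homog d f = homog (d - tdeg b) a * homog (tdeg b) b"
    unfolding ab using homog_mult[OF *(1), of b "tdeg b"] *(2) by simp
  then have "is_unit (homog (d - tdeg b) a) \<or> is_unit (homog (tdeg b) b)"
    using assms(1) by (metis irreducibleD)
  then show "is_unit a \<or> is_unit b"
    using is_unit_poly_1 poly_homog_1[OF *(1)] poly_homog_1[of b "tdeg b"] by (metis order_refl)
qed

text \<open>Homogenization to the exact degree is multiplicative, so it carries the prime
  factorization of F along.\<close>

lemma prime_dvd_homog_imp:
  assumes "prime_elem p" "F \<noteq> 0" "p dvd homog (tdeg F) F"
  shows "\<exists>q\<in>prime_factors F. p dvd homog (tdeg q) q"
  using assms(2,3)
proof (induction F rule: prime_divisors_induct)
  case (unit x)
  then obtain c where c: "c \<noteq> 0" "x = bconst c" by (auto simp: is_unit_bipoly_iff)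
  then have "is_unit (homog (tdeg x) x)"
    by (auto simp: homog_bconst is_unit_tripoly_iff)
  then show ?case using unit assms(1) by (meson dvd_trans prime_elem_not_unit)
next
  case (factor q x)
  then have nz: "q \<noteq> 0" "x \<noteq> 0" by auto
  have "homog (tdeg (q * x)) (q * x) = homog (tdeg q) q * homog (tdeg x) x"
    using nz by (simp add: tdeg_mult homog_mult)
  then have "p dvd homog (tdeg q) q \<or> p dvd homog (tdeg x) x"
    using factor(4) assms(1) by (simp add: prime_elem_dvd_mult_iff)
  moreover have "q \<in> prime_factors (q * x)" "prime_factors x \<subseteq> prime_factors (q * x)"
    using nz factor(1) by (auto simp: in_prime_factors_iff)
  ultimately show ?case using factor(2) nz by auto
qed auto

text \<open>Up to association, an irreducible factor is either the homogenization of a prime factor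
  of F or the line at infinity Z, and Z occurs only if the degree drops below d.\<close>

lemma n_factors_homog_le:
  assumes "F \<noteq> 0" "tdeg F \<le> d"
  shows "n_factors (homog d F) \<le> card (prime_factors F) + (if tdeg F < d then 1 else 0)"
proof -
  define R :: "(tripoly \<times> tripoly) set" where "R = {(p, q). p dvd q \<and> q dvd p}"
  define C where "C = (\<lambda>q. R `` {homog (tdeg q) q}) ` prime_factors F
    \<union> (if tdeg F < d then {R `` {[:0, 1:]}} else {})"
  have cls: "R `` {p} = R `` {q}" if "p dvd q" "irreducible p" "irreducible q" for p q
  proof -
    have "q dvd p" using that by (metis irreducibleD' irreducible_not_unit)
    then show ?thesis using that(1) by (auto simp: R_def intro: dvd_trans)
  qed
  have "{p. irreducible p \<and> p dvd homog d F} // R \<subseteq> C"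
  proof
    fix K assume "K \<in> {p. irreducible p \<and> p dvd homog d F} // R"
    then obtain p where p: "irreducible p" "p dvd homog d F" "K = R `` {p}"
      by (auto simp: quotient_def)
    have pr: "prime_elem p" using p(1) by (rule irreducible_imp_prime_elem)
    have "homog d F = [:0, 1:] ^ (d - tdeg F) * homog (tdeg F) F"
      using homog_add_degree[of F "tdeg F" "d - tdeg F"] assms(2) by simp
    then have "p dvd [:0, 1:] ^ (d - tdeg F) \<or> p dvd homog (tdeg F) F"
      using p(2) pr by (metis prime_elem_dvd_mult_iff)
    then show "K \<in> C"
    proof
      assume "p dvd [:0, 1:] ^ (d - tdeg F)"
      then have "p dvd [:0, 1:]" "d - tdeg F > 0"
        using pr by (auto simp only: prime_elem_dvd_power_iff)
      then show "K \<in> C"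
        using cls[of p "[:0, 1:]"] p prime_elem_Z by (auto simp: C_def prime_elem_imp_irreducible)
    next
      assume "p dvd homog (tdeg F) F"
      then obtain q where q: "q \<in> prime_factors F" "p dvd homog (tdeg q) q"
        using prime_dvd_homog_imp[OF pr assms(1)] by blast
      then have "irreducible (homog (tdeg q) q)"
        by (intro irreducible_homog) (auto simp: in_prime_factors_iff prime_elem_imp_irreducible)
      then show "K \<in> C"
        using cls[OF q(2) p(1)] p(3) q(1) by (auto simp: C_def)
    qed
  qed
  moreover have "finite C" by (auto simp: C_def)
  ultimately have "n_factors (homog d F) \<le> card C"
    unfolding n_factors_def R_def[symmetric] by (intro card_mono) auto
  also have "\<dots> \<le> card (prime_factors F) + (if tdeg F < d then 1 else 0)"
    unfolding C_def by (rule order_trans[OF card_Un_le]) (auto intro!: add_mono card_image_le)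
  finally show ?thesis .
qed

section \<open>Newton polygons of cofactors\<close>

text \<open>A homogeneous linear system with more unknowns than equations, solved by Gaussian
  elimination: one equation and the pivot unknown \<open>i0\<close> are removed together.\<close>

lemma exists_nontrivial_relation:
  fixes a :: "'i \<Rightarrow> 'l \<Rightarrow> 'a :: field"
  assumes "finite L" "finite I" "card L < card I"
  shows "\<exists>c. (\<exists>i\<in>I. c i \<noteq> 0) \<and> (\<forall>l\<in>L. (\<Sum>i\<in>I. c i * a i l) = 0)"
  using assms
proof (induction L arbitrary: I a rule: finite_induct)
  case empty
  then have "I \<noteq> {}" by auto
  then show ?case by (intro exI[of _ "\<lambda>_. 1"]) auto
next
  case (insert l L)
  show ?case
  proof (cases "\<forall>i\<in>I. a i l = 0")
    case True
    have "card L < card I" using insert by simp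
    then obtain c where "\<exists>i\<in>I. c i \<noteq> 0" "\<forall>m\<in>L. (\<Sum>i\<in>I. c i * a i m) = 0"
      using insert.IH[of I a] insert.prems by blast
    then show ?thesis using True by (intro exI[of _ c]) auto
  next
    case False
    then obtain i0 where i0: "i0 \<in> I" "a i0 l \<noteq> 0" by blast
    define I' where "I' = I - {i0}"
    have I': "finite I'" "card L < card I'" "i0 \<notin> I'"
      using insert i0 by (auto simp: I'_def)
    have split: "(\<Sum>i\<in>I. f i) = f i0 + (\<Sum>i\<in>I'. f i)" for f :: "'i \<Rightarrow> 'a"
      using i0 insert.prems unfolding I'_def by (intro sum.remove) auto
    obtain c where c: "\<exists>i\<in>I'. c i \<noteq> 0"
      "\<forall>m\<in>L. (\<Sum>i\<in>I'. c i * (a i m - a i l / a i0 l * a i0 m)) = 0"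
      using insert.IH[OF I'(1,2), of "\<lambda>i m. a i m - a i l / a i0 l * a i0 m"] by blast
    \<comment> \<open>Equation l, solved for the eliminated unknown.\<close>
    define c0 where "c0 = - (\<Sum>i\<in>I'. c i * a i l) / a i0 l"
    define c' where "c' = c(i0 := c0)"
    have "(\<Sum>i\<in>I. c' i * a i m) = c0 * a i0 m + (\<Sum>i\<in>I'. c i * a i m)" for m
    proof -
      have "(\<Sum>i\<in>I'. c' i * a i m) = (\<Sum>i\<in>I'. c i * a i m)"
        using I'(3) by (intro sum.cong) (auto simp: c'_def)
      then show ?thesis by (simp add: split c'_def)
    qed
    moreover have "c0 * a i0 m + (\<Sum>i\<in>I'. c i * a i m) = 0" if "m \<in> insert l L" for m
    proof (cases "m = l")
      case True
      then show ?thesis using i0 by (simp add: c0_def)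
    next
      case False
      then have "(\<Sum>i\<in>I'. c i * (a i m - a i l / a i0 l * a i0 m)) = 0" using c(2) that by auto
      moreover have "(\<Sum>i\<in>I'. c i * (a i m - a i l / a i0 l * a i0 m))
          = (\<Sum>i\<in>I'. c i * a i m) - (\<Sum>i\<in>I'. c i * a i l) / a i0 l * a i0 m"
        unfolding right_diff_distrib sum_subtractf sum_divide_distrib sum_distrib_right
        by (simp add: mult.assoc)
      ultimately show ?thesis by (simp add: c0_def)
    qed
    moreover have "\<exists>i\<in>I. c' i \<noteq> 0"
      using c(1) by (auto simp: c'_def I'_def)
    ultimately show ?thesis by (intro exI[of _ c']) simp
  qed
qed

section \<open>Finiteness of supports and lattice points\<close>

lemma finite_laurent_support: "finite (laurent_support A B x y)"
proof -
  let ?f = "\<lambda>(i, j). (int i - 1, int j)" and ?g = "\<lambda>(i, j). (int i, int j - 1)"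
  let ?U = "?f ` {(i, j). cf A i j \<noteq> 0} \<union> ?g ` {(i, j). cf B i j \<noteq> 0}"
  have "(a, b) \<in> ?U" if "(a, b) \<in> laurent_support A B x y" for a b
  proof -
    have "cfi A (a + 1) b \<noteq> 0 \<or> cfi B a (b + 1) \<noteq> 0"
      using that by (auto simp: laurent_support_def)
    then show ?thesis
    proof
      assume "cfi A (a + 1) b \<noteq> 0"
      then have "(a, b) \<in> ?f ` {(i, j). cf A i j \<noteq> 0}"
        by (intro image_eqI[of _ _ "(nat (a + 1), nat b)"]) (auto simp: cfi_def split: if_splits)
      then show ?thesis by (rule UnI1)
    next
      assume "cfi B a (b + 1) \<noteq> 0"
      then have "(a, b) \<in> ?g ` {(i, j). cf B i j \<noteq> 0}"
        by (intro image_eqI[of _ _ "(nat a, nat (b + 1))"]) (auto simp: cfi_def split: if_splits)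
      then show ?thesis by (rule UnI2)
    qed
  qed
  then have "laurent_support A B x y \<subseteq> ?U"
    by (intro subrelI)
  then show ?thesis
    by (rule finite_subset) (intro finite_UnI finite_imageI finite_support)
qed

lemma compact_newton_polygon: "finite S \<Longrightarrow> compact (newton_polygon S)"
  unfolding newton_polygon_def by (intro finite_imp_compact_convex_hull finite_imageI)

lemma finite_lattice_points:
  assumes "finite S"
  shows "finite {(a :: nat, b :: nat). (real a, real b) \<in> newton_polygon S}"
proof -
  obtain K where K: "\<And>z. z \<in> newton_polygon S \<Longrightarrow> norm z \<le> K"
    using compact_imp_bounded[OF compact_newton_polygon[OF assms]] by (auto simp: bounded_iff)
  have "a \<le> nat \<lceil>K\<rceil> \<and> b \<le> nat \<lceil>K\<rceil>" if "(real a, real b) \<in> newton_polygon S" for a b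
  proof -
    have "real a \<le> norm (real a, real b)" "real b \<le> norm (real a, real b)"
      using norm_fst_le[of "real a" "real b"] norm_snd_le[of "real b" "real a"] by auto
    then show ?thesis using K[OF that] by linarith
  qed
  then have "{(a, b). (real a, real b) \<in> newton_polygon S} \<subseteq> {..nat \<lceil>K\<rceil>} \<times> {..nat \<lceil>K\<rceil>}"
    by auto
  then show ?thesis by (rule finite_subset) auto
qed

text \<open>Genericity means absence of cancellation: the support is then the union of the supports
  of A/X and B/Y, the largest possible.\<close>

definition generic_pt :: "bipoly \<Rightarrow> bipoly \<Rightarrow> complex \<Rightarrow> complex \<Rightarrow> bool" where
  "generic_pt A B x y \<longleftrightarrow> (\<forall>a b. cfi A (a + 1) b \<noteq> 0 \<or> cfi B a (b + 1) \<noteq> 0 \<longrightarrow>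
     (a, b) \<in> laurent_support A B x y)"

text \<open>At each of the finitely many relevant exponents, cancellation is the vanishing of a
  nonzero linear form in x and y; P is the product of these forms.\<close>

lemma exists_generic_polynomial:
  "\<exists>P. P \<noteq> 0 \<and> (\<forall>x y. eval2 P x y \<noteq> 0 \<longrightarrow> generic_pt A B x y)"
proof -
  define S where "S = {(a, b). cfi A (a + 1) b \<noteq> 0 \<or> cfi B a (b + 1) \<noteq> 0}"
  have "S \<subseteq> laurent_support A 0 1 1 \<union> laurent_support 0 B 1 1"
    by (auto simp: S_def laurent_support_def cfi_def)
  then have fin: "finite S"
    by (rule finite_subset) (simp add: finite_laurent_support)
  define P :: bipoly where
    "P = (\<Prod>(a, b)\<in>S. [:[:0, cfi A (a + 1) b:], [:cfi B a (b + 1):]:])"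
  have "P \<noteq> 0" using fin by (auto simp: P_def S_def)
  moreover have "generic_pt A B x y" if "eval2 P x y \<noteq> 0" for x y
    unfolding generic_pt_def
  proof (intro allI impI)
    fix a b assume ab: "cfi A (a + 1) b \<noteq> 0 \<or> cfi B a (b + 1) \<noteq> 0"
    have "eval2 P x y = (\<Prod>(a, b)\<in>S. x * cfi A (a + 1) b + y * cfi B a (b + 1))"
      unfolding P_def eval2_def poly_prod by (intro prod.cong) auto
    moreover have "(a, b) \<in> S" using ab by (simp add: S_def)
    ultimately show "(a, b) \<in> laurent_support A B x y"
      using that fin by (auto simp: laurent_support_def)
  qed
  ultimately show ?thesis by blast
qed

text \<open>Since \<open>X \<partial>\<^sub>X\<close> and \<open>Y \<partial>\<^sub>Y\<close> act diagonally on monomials, \<open>D p\<close> is supported in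
  \<open>N(p) + N\<^sub>D\<close>. A point of the support of the cofactor outside \<open>N\<^sub>D\<close> is separated from it
  by a linear functional, along which the leading term of \<open>L * p\<close> would be too large.\<close>

lemma cofactor_support:
  assumes D: "deriv2 A B p = L * p" and "p \<noteq> 0" and gen: "generic_pt A B x y"
    and nz: "cf L i j \<noteq> 0"
  shows "(real i, real j) \<in> newton_polygon (laurent_support A B x y)"
proof (rule ccontr)
  define N where "N = newton_polygon (laurent_support A B x y)"
  assume "(real i, real j) \<notin> newton_polygon (laurent_support A B x y)"
  then obtain w b where w: "w \<bullet> (real i, real j) < b" "\<forall>z\<in>N. b < w \<bullet> z"
    using separating_hyperplane_closed_point[of N "(real i, real j)"]
      compact_newton_polygon[OF finite_laurent_support, THEN compact_imp_closed]
    unfolding N_def newton_polygon_def by (metis convex_convex_hull)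
  \<comment> \<open>The change of sign puts \<open>N\<close> strictly below (i, j), matching the
    maxima in \<open>leading_term_mult\<close>.\<close>
  define u v where "u = - fst w" and "v = - snd w"
  have in_N: "u * real_of_int a + v * real_of_int b < u * real i + v * real j"
    if "(a, b) \<in> laurent_support A B x y" for a b
  proof -
    have "(real_of_int a, real_of_int b) \<in> N"
      unfolding N_def newton_polygon_def by (rule hull_inc) (use that in force)
    then have "w \<bullet> (real i, real j) < w \<bullet> (real_of_int a, real_of_int b)"
      using w by force
    then show ?thesis by (cases w) (auto simp: u_def v_def inner_prod_def)
  qed
  have "L \<noteq> 0" using nz by auto
  then obtain i1 j1 i2 j2 where lt: "cf (L * p) (i1 + i2) (j1 + j2) \<noteq> 0"
    "\<And>s t. cf L s t \<noteq> 0 \<Longrightarrow> u * s + v * t \<le> u * i1 + v * j1"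
    "\<And>s t. cf p s t \<noteq> 0 \<Longrightarrow> u * s + v * t \<le> u * i2 + v * j2"
    using leading_term_mult[OF _ \<open>p \<noteq> 0\<close>, of L u v] by metis
  have "cf (A * dX p) (i1 + i2) (j1 + j2) \<noteq> 0 \<or> cf (B * dY p) (i1 + i2) (j1 + j2) \<noteq> 0"
    using lt(1) unfolding D[symmetric] deriv2_def cf_add by auto
  then show False
  proof
    assume "cf (A * dX p) (i1 + i2) (j1 + j2) \<noteq> 0"
    then obtain a b s t where *: "cf A a b \<noteq> 0" "cf (dX p) s t \<noteq> 0" "i1 + i2 = a + s" "j1 + j2 = b + t"
      by (rule cf_mult_nonzeroE)
    \<comment> \<open>The exponent is regrouped as (a - 1, b) + (s + 1, t): a point of the Laurent
      support plus one of the support of p.\<close>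
    have "cfi A (int a - 1 + 1) (int b) \<noteq> 0" using *(1) by (simp add: cfi_def)
    then have "(int a - 1, int b) \<in> laurent_support A B x y"
      using gen unfolding generic_pt_def by blast
    note 1 = in_N[OF this]
    have "cf p (Suc s) t \<noteq> 0" using *(2) by (auto simp: cf_dX)
    note 2 = lt(3)[OF this]
    have 3: "real i1 + real i2 = real a + real s" "real j1 + real j2 = real b + real t"
      using *(3,4) by (simp_all flip: of_nat_add)
    have "u * (real i1 + real i2) + v * (real j1 + real j2)
        = (u * (real a - 1) + v * real b) + (u * (real s + 1) + v * real t)"
      unfolding 3 by (simp add: algebra_simps)
    then show False
      using 1 2 lt(2)[OF nz] by (simp add: algebra_simps)
  next
    assume "cf (B * dY p) (i1 + i2) (j1 + j2) \<noteq> 0"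
    then obtain a b s t where *: "cf B a b \<noteq> 0" "cf (dY p) s t \<noteq> 0" "i1 + i2 = a + s" "j1 + j2 = b + t"
      by (rule cf_mult_nonzeroE)
    have "cfi B (int a) (int b - 1 + 1) \<noteq> 0" using *(1) by (simp add: cfi_def)
    then have "(int a, int b - 1) \<in> laurent_support A B x y"
      using gen unfolding generic_pt_def by blast
    note 1 = in_N[OF this]
    have "cf p s (Suc t) \<noteq> 0" using *(2) by (auto simp: cf_dY)
    note 2 = lt(3)[OF this]
    have 3: "real i1 + real i2 = real a + real s" "real j1 + real j2 = real b + real t"
      using *(3,4) by (simp_all flip: of_nat_add)
    have "u * (real i1 + real i2) + v * (real j1 + real j2)
        = (u * real a + v * (real b - 1)) + (u * real s + v * (real t + 1))"
      unfolding 3 by (simp add: algebra_simps)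
    then show False
      using 1 2 lt(2)[OF nz] by (simp add: algebra_simps)
  qed
qed

text \<open>All cofactors are supported on the lattice points of the polygon, so a relation imposes
  \<open>lattice_count\<close> linear conditions on more unknowns.\<close>

lemma cofactors_dependent:
  assumes "finite J" "lattice_count A B x y < card J" "generic_pt A B x y"
    "\<And>p. p \<in> J \<Longrightarrow> p \<noteq> 0 \<and> deriv2 A B p = L p * p"
  shows "\<exists>c. (\<exists>p\<in>J. c p \<noteq> 0) \<and> (\<Sum>p\<in>J. bconst (c p) * L p) = 0"
proof -
  define T where "T = {(a :: nat, b :: nat). (real a, real b) \<in> newton_polygon (laurent_support A B x y)}"
  have "finite T" "card T < card J"
    using finite_lattice_points[OF finite_laurent_support] assms(2)
    unfolding T_def lattice_count_def by auto
  then obtain c where c: "\<exists>p\<in>J. c p \<noteq> 0" "\<forall>l\<in>T. (\<Sum>p\<in>J. c p * (case l of (a, b) \<Rightarrow> cf (L p) a b)) = 0"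
    using exists_nontrivial_relation[of T J "\<lambda>p l. case l of (a, b) \<Rightarrow> cf (L p) a b"] assms(1) by blast
  have "(\<Sum>p\<in>J. bconst (c p) * L p) = 0"
  proof (rule bipoly_eqI)
    fix i j
    show "cf (\<Sum>p\<in>J. bconst (c p) * L p) i j = cf 0 i j"
    proof (cases "(i, j) \<in> T")
      case True
      then show ?thesis using c(2) by (auto simp: cf_sum)
    next
      case False
      then have "cf (L p) i j = 0" if "p \<in> J" for p
        using cofactor_support[of A B p "L p" x y i j] assms(3,4) that by (auto simp: T_def)
      then show ?thesis by (simp add: cf_sum)
    qed
  qed
  then show ?thesis using c(1) by blast
qed

section \<open>Algebraic dependence of first integrals\<close>

lemma tdeg_mult_le: "tdeg (p * q) \<le> tdeg p + tdeg q"
  by (cases "p = 0 \<or> q = 0") (auto simp: tdeg_mult)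

lemma tdeg_power_le: "tdeg (p ^ n) \<le> n * tdeg p"
proof (induction n)
  case 0
  then show ?case using tdeg_bconst[of 1] by simp
next
  case (Suc n)
  then show ?case using tdeg_mult_le[of p "p ^ n"] by simp
qed

lemma of_nat_bipoly: "(of_nat n :: bipoly) = bconst (of_nat n)"
  by (simp add: of_nat_poly bconst_def)

context derivation
begin

text \<open>All \<open>R k\<close> have the logarithmic derivative \<Theta>/h, so their ratios are
  first integrals. Applying \<open>d\<close> to the relation therefore acts like differentiation
  with respect to t and lowers its degree in t by one.\<close>

lemma independent_powers:
  assumes "d t \<noteq> 0" "h \<noteq> 0" "\<And>k. k \<le> K \<Longrightarrow> h * d (R k) = \<Theta> * R k"
    "(\<Sum>k\<le>K. R k * t ^ k) = 0" "k \<le> K"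
  shows "R k = 0"
  using assms(3-5)
proof (induction K arbitrary: R k)
  case 0
  then show ?case by simp
next
  case (Suc K)
  have "0 = h * d (\<Sum>k\<le>Suc K. R k * t ^ k)"
    using Suc.prems(2) by simp
  also have "\<dots> = (\<Sum>k\<le>Suc K. (h * d (R k)) * t ^ k + h * (R k * d (t ^ k)))"
    unfolding sum sum_distrib_left mult by (simp add: algebra_simps)
  also have "\<dots> = \<Theta> * (\<Sum>k\<le>Suc K. R k * t ^ k) + h * (\<Sum>k\<le>Suc K. R k * d (t ^ k))"
    unfolding sum_distrib_left sum.distrib[symmetric]
    using Suc.prems(1) by (intro sum.cong refl) (simp add: mult_ac)
  also have "\<dots> = h * (\<Sum>k\<le>Suc K. R k * d (t ^ k))"
    using Suc.prems(2) by simp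
  also have "(\<Sum>k\<le>Suc K. R k * d (t ^ k)) = d t * (\<Sum>k\<le>K. (of_nat (Suc k) * R (Suc k)) * t ^ k)"
    by (subst sum.atMost_Suc_shift) (simp add: power_Suc sum_distrib_left mult_ac del: of_nat_Suc Power.power_Suc)
  finally have *: "(\<Sum>k\<le>K. (of_nat (Suc k) * R (Suc k)) * t ^ k) = 0"
    using assms(1,2) by simp
  have R_Suc: "R (Suc k) = 0" if "k \<le> K" for k
  proof -
    have "of_nat (Suc k) * R (Suc k) = 0"
    proof (rule Suc.IH[OF _ * that])
      fix k assume "k \<le> K"
      then show "h * d (of_nat (Suc k) * R (Suc k)) = \<Theta> * (of_nat (Suc k) * R (Suc k))"
        using Suc.prems(1)[of "Suc k"] unfolding of_nat_bipoly scale by (simp add: mult_ac)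
    qed
    then show ?thesis by (simp del: of_nat_Suc)
  qed
  have "(\<Sum>k\<le>Suc K. R k * t ^ k) = R 0"
    by (subst sum.atMost_Suc_shift) (simp add: R_Suc)
  then have "R 0 = 0" using Suc.prems(2) by simp
  then show ?case using R_Suc Suc.prems(3) by (cases k) auto
qed

text \<open>The product is \<open>(F/G) ^ i * G ^ n\<close> with F/G a first integral, so its
  logarithmic derivative is that of \<open>G ^ n\<close>, whatever i is.\<close>

lemma log_deriv_monomial:
  assumes "d F * G = F * d G" "i \<le> n"
  shows "G * d (F ^ i * G ^ (n - i)) = of_nat n * d G * (F ^ i * G ^ (n - i))"
proof -
  have 1: "G * d (G ^ m) = of_nat m * d G * G ^ m" for m
    by (induction m) (auto simp: mult algebra_simps)
  have "G * d (F ^ i * G ^ m) = of_nat (i + m) * d G * (F ^ i * G ^ m)" for m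
  proof (induction i)
    case (Suc i)
    have "G * d (F ^ Suc i * G ^ m) = (d F * G) * (F ^ i * G ^ m) + F * (G * d (F ^ i * G ^ m))"
      by (simp add: mult algebra_simps)
    also have "\<dots> = of_nat (Suc i + m) * d G * (F ^ Suc i * G ^ m)"
      unfolding assms(1) Suc by (simp add: algebra_simps)
    finally show ?case .
  qed (simp add: 1)
  from this[of "n - i"] show ?thesis using assms(2) by simp
qed

text \<open>Among the \<open>(n + 1) ^ 3\<close> products \<open>F ^ i * G ^ (n - i) * p ^ j * q ^ (n - j) * t ^ k\<close>
  there is a linear relation for large \<open>n\<close>, as their degrees are \<open>O(n)\<close>. Since \<open>D t \<noteq> 0\<close>,
  applying \<open>D\<close> removes \<open>t\<close> from it.\<close>

lemma first_integrals_dependent: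
  assumes t: "d t \<noteq> 0" and "G \<noteq> 0" "q \<noteq> 0"
    and F: "d F * G = F * d G" and p: "d p * q = p * d q"
  shows "\<exists>n s. (\<exists>i\<le>n. \<exists>j\<le>n. s i j \<noteq> 0) \<and>
    (\<Sum>i\<le>n. \<Sum>j\<le>n. bconst (s i j) * (F ^ i * G ^ (n - i) * (p ^ j * q ^ (n - j)))) = 0"
proof -
  define M where "M = tdeg F + tdeg G + tdeg p + tdeg q + tdeg t + 1"
  \<comment> \<open>With this choice (nM + 1)^2 \<le> M^2 (n + 1)^2 = n (n + 1)^2 < (n + 1)^3, so
    the products outnumber the exponents.\<close>
  define n where "n = M * M"
  define e where "e = (\<lambda>i j. F ^ i * G ^ (n - i) * (p ^ j * q ^ (n - j)))"
  define I where "I = {..n} \<times> {..n} \<times> {..n}"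
  define L where "L = {..n * M} \<times> {..n * M}"
  have "n * M + 1 \<le> M * (n + 1)" by (simp add: M_def)
  then have "(n * M + 1) * (n * M + 1) \<le> (M * (n + 1)) * (M * (n + 1))"
    by (intro mult_mono) auto
  also have "\<dots> = n * ((n + 1) * (n + 1))" by (simp add: n_def algebra_simps)
  also have "\<dots> < (n + 1) * ((n + 1) * (n + 1))" by simp
  finally have "card L < card I" by (simp add: I_def L_def)
  then obtain c where c: "\<exists>x\<in>I. c x \<noteq> 0"
    "\<forall>l\<in>L. (\<Sum>x\<in>I. c x * (case (x, l) of ((i, j, k), (a, b)) \<Rightarrow> cf (e i j * t ^ k) a b)) = 0"
    using exists_nontrivial_relation[of L I "\<lambda>x l. case (x, l) of ((i, j, k), (a, b)) \<Rightarrow> cf (e i j * t ^ k) a b"]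
    by (auto simp: I_def L_def)
  define R where "R = (\<lambda>k. \<Sum>i\<le>n. \<Sum>j\<le>n. bconst (c (i, j, k)) * e i j)"
  have deg: "tdeg (e i j * t ^ k) \<le> n * M" if "i \<le> n" "j \<le> n" "k \<le> n" for i j k
  proof -
    have "tdeg (e i j * t ^ k) \<le> i * tdeg F + (n - i) * tdeg G + (j * tdeg p + (n - j) * tdeg q) + k * tdeg t"
      unfolding e_def by (intro order_trans[OF tdeg_mult_le] add_mono tdeg_power_le)
    also have "\<dots> \<le> n * tdeg F + n * tdeg G + (n * tdeg p + n * tdeg q) + n * tdeg t"
      using that by (intro add_mono mult_right_mono) auto
    also have "\<dots> \<le> n * M" by (simp add: M_def algebra_simps)
    finally show ?thesis .
  qed
  have sum_I: "(\<Sum>k\<le>n. \<Sum>i\<le>n. \<Sum>j\<le>n. f i j k) = (\<Sum>(i, j, k)\<in>I. f i j k)" for f :: "nat \<Rightarrow> nat \<Rightarrow> nat \<Rightarrow> complex"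
  proof -
    have "(\<Sum>k\<le>n. \<Sum>i\<le>n. \<Sum>j\<le>n. f i j k) = (\<Sum>i\<le>n. \<Sum>k\<le>n. \<Sum>j\<le>n. f i j k)"
      by (rule sum.swap)
    also have "\<dots> = (\<Sum>i\<le>n. \<Sum>j\<le>n. \<Sum>k\<le>n. f i j k)"
      by (intro sum.cong refl sum.swap)
    finally show ?thesis by (simp add: I_def sum.cartesian_product)
  qed
  have rel: "(\<Sum>k\<le>n. R k * t ^ k) = 0"
  proof (rule bipoly_eqI)
    fix a b
    have "cf (\<Sum>k\<le>n. R k * t ^ k) a b = (\<Sum>k\<le>n. \<Sum>i\<le>n. \<Sum>j\<le>n. c (i, j, k) * cf (e i j * t ^ k) a b)"
      unfolding R_def sum_distrib_right cf_sum mult.assoc cf_bconst_mult ..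
    also have "\<dots> = (\<Sum>x\<in>I. c x * (case (x, (a, b)) of ((i, j, k), (a, b)) \<Rightarrow> cf (e i j * t ^ k) a b))"
      unfolding sum_I by (intro sum.cong) auto
    also have "\<dots> = 0"
    proof (cases "(a, b) \<in> L")
      case True
      then show ?thesis using c(2) by blast
    next
      case False
      then have "a + b > n * M" by (auto simp: L_def)
      then have "cf (e i j * t ^ k) a b = 0" if "(i, j, k) \<in> I" for i j k
        using deg[of i j k] le_tdeg[of "e i j * t ^ k" a b] that by (force simp: I_def)
      then show ?thesis by (intro sum.neutral) auto
    qed
    finally show "cf (\<Sum>k\<le>n. R k * t ^ k) a b = cf 0 a b" by simp
  qed
  \<comment> \<open>The common logarithmic derivative that \<open>independent_powers\<close> asks
    for: n times that of G * q.\<close>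
  have R: "(G * q) * d (R k) = (of_nat n * (d G * q + d q * G)) * R k" for k
  proof -
    have "(G * q) * d (e i j) = (of_nat n * (d G * q + d q * G)) * e i j" if "i \<le> n" "j \<le> n" for i j
    proof -
      have "(G * q) * d (e i j) = q * (p ^ j * q ^ (n - j)) * (G * d (F ^ i * G ^ (n - i)))
          + G * (F ^ i * G ^ (n - i)) * (q * d (p ^ j * q ^ (n - j)))"
        unfolding e_def mult[of "F ^ i * G ^ (n - i)"] by (simp add: algebra_simps)
      then show ?thesis
        unfolding log_deriv_monomial[OF F that(1)] log_deriv_monomial[OF p that(2)]
        by (simp add: e_def algebra_simps)
    qed
    then have "bconst s * ((G * q) * d (e i j)) = (of_nat n * (d G * q + d q * G)) * (bconst s * e i j)"
      if "i \<le> n" "j \<le> n" for i j s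
      using that by simp
    then show ?thesis
      unfolding R_def sum scale sum_distrib_left
      by (intro sum.cong refl) (simp add: mult_ac)
  qed
  have "G * q \<noteq> 0" using assms(2,3) by simp
  then have "R k = 0" if "k \<le> n" for k
    using independent_powers[OF t _ R rel that] by blast
  moreover obtain i j k where "(i, j, k) \<in> I" "c (i, j, k) \<noteq> 0"
    using c(1) by force
  ultimately show ?thesis
    unfolding R_def e_def by (intro exI[of _ n] exI[of _ "\<lambda>i j. c (i, j, k)"]) (auto simp: I_def)
qed

end

text \<open>For \<open>degree s \<le> n\<close> this is \<open>q ^ n * s(p/q)\<close>; a gap between
  \<open>degree s\<close> and n stands for a root at infinity.\<close>

definition form :: "complex poly \<Rightarrow> nat \<Rightarrow> bipoly \<Rightarrow> bipoly \<Rightarrow> bipoly" where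
  "form s n p q = (\<Sum>i\<le>n. bconst (coeff s i) * (p ^ i * q ^ (n - i)))"

lemma form_linear_factor:
  assumes "degree s \<le> n"
  shows "form ([:- r, 1:] * s) (Suc n) p q = (p - bconst r * q) * form s n p q"
proof -
  have "form s (Suc n) p q = q * form s n p q"
    unfolding form_def sum_distrib_left using assms
    by (simp add: coeff_eq_0 Suc_diff_le mult_ac)
  moreover have "form (pCons 0 s) (Suc n) p q = p * form s n p q"
    unfolding form_def sum_distrib_left by (subst sum.atMost_Suc_shift) (simp add: mult_ac)
  moreover have "form ([:- r, 1:] * s) (Suc n) p q = form (pCons 0 s) (Suc n) p q - bconst r * form s (Suc n) p q"
  proof -
    have "coeff ([:- r, 1:] * s) i = coeff (pCons 0 s) i - r * coeff s i" for i by simp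
    then show ?thesis
      unfolding form_def sum_distrib_left sum_subtractf[symmetric]
      by (intro sum.cong refl) (simp only: bconst_diff bconst_mult left_diff_distrib mult.assoc)
  qed
  ultimately show ?thesis by (simp add: algebra_simps)
qed

text \<open>Over C a binary form splits into linear forms: the roots r of s give p - r q, and the
  root at infinity gives q.\<close>

lemma prime_dvd_form_imp:
  assumes "prime_elem P" "s \<noteq> 0" "degree s \<le> n" "P dvd form s n p q"
  shows "\<exists>l m. (l \<noteq> 0 \<or> m \<noteq> 0) \<and> P dvd bconst l * p - bconst m * q"
  using assms(2-4)
proof (induction n arbitrary: s)
  case 0
  then obtain c where "s = [:c:]" "c \<noteq> 0" by (auto elim: degree_eq_zeroE)
  then have "P dvd bconst c" using 0 by (simp add: form_def)
  then show ?case
    using is_unit_bconst[OF \<open>c \<noteq> 0\<close>] assms(1) by (meson dvd_trans prime_elem_not_unit)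
next
  case (Suc n)
  show ?case
  proof (cases "degree s = 0")
    case True
    then obtain c where c: "s = [:c:]" "c \<noteq> 0" using Suc by (auto elim: degree_eq_zeroE)
    have "form s (Suc n) p q = bconst c * q ^ Suc n"
      unfolding form_def c by (subst sum.atMost_Suc_shift) simp
    then have "P dvd bconst c \<or> P dvd q ^ Suc n"
      using Suc.prems(3) assms(1) by (metis prime_elem_dvd_mult_iff)
    then have "P dvd q"
      using is_unit_bconst[OF c(2)] assms(1) by (meson dvd_trans prime_elem_dvd_power prime_elem_not_unit)
    then show ?thesis by (intro exI[of _ 0] exI[of _ 1]) simp
  next
    case False
    then obtain r where "poly s r = 0"
      using fundamental_theorem_of_algebra constant_degree by metis
    then obtain s' where s': "s = [:- r, 1:] * s'"
      by (metis dvdE poly_eq_0_iff_dvd)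
    then have "s' \<noteq> 0" using Suc.prems(1) by auto
    then have "degree s = degree [:- r, 1:] + degree s'"
      unfolding s' by (intro degree_mult_eq) auto
    then have "degree s' \<le> n" using Suc.prems(2) by simp
    have "P dvd (p - bconst r * q) * form s' n p q"
      using Suc.prems(3) unfolding s' form_linear_factor[OF \<open>degree s' \<le> n\<close>] .
    then have "P dvd p - bconst r * q \<or> P dvd form s' n p q"
      using assms(1) by (simp add: prime_elem_dvd_mult_iff)
    then show ?thesis
    proof
      assume "P dvd p - bconst r * q"
      then show ?thesis by (intro exI[of _ 1] exI[of _ r]) simp
    qed (use Suc.IH \<open>s' \<noteq> 0\<close> \<open>degree s' \<le> n\<close> in blast)
  qed
qed

text \<open>After division by the lowest power of F, the algebraic relation between F/G and p/q
  reduces modulo F to a nonzero binary form in p and q. One of its linear factors is divisible by F,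
  so p/q is constant, possibly infinite, on F = 0.\<close>

lemma (in derivation) first_integral_constant_on_curve:
  assumes t: "d t \<noteq> 0" and F: "prime_elem F" "\<not> F dvd G" "d F * G = F * d G"
    and p: "q \<noteq> 0" "d p * q = p * d q"
  shows "\<exists>l m. (l \<noteq> 0 \<or> m \<noteq> 0) \<and> F dvd bconst l * p - bconst m * q"
proof -
  have "G \<noteq> 0" using F(2) by auto
  then obtain n s where ns: "\<exists>i\<le>n. \<exists>j\<le>n. s i j \<noteq> 0"
    "(\<Sum>i\<le>n. \<Sum>j\<le>n. bconst (s i j) * (F ^ i * G ^ (n - i) * (p ^ j * q ^ (n - j)))) = 0"
    using first_integrals_dependent[OF t _ p(1) F(3) p(2)] by blast
  define T where "T = (\<lambda>i. \<Sum>j\<le>n. bconst (s i j) * (p ^ j * q ^ (n - j)))"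
  define i0 where "i0 = (LEAST i. i \<le> n \<and> (\<exists>j\<le>n. s i j \<noteq> 0))"
  have i0: "i0 \<le> n" "\<exists>j\<le>n. s i0 j \<noteq> 0"
    using LeastI_ex[of "\<lambda>i. i \<le> n \<and> (\<exists>j\<le>n. s i j \<noteq> 0)"] ns(1) unfolding i0_def by blast+
  have T0: "T i = 0" if "i < i0" for i
  proof -
    have "\<forall>j\<le>n. s i j = 0"
      using not_less_Least[of i "\<lambda>i. i \<le> n \<and> (\<exists>j\<le>n. s i j \<noteq> 0)"] that i0(1) unfolding i0_def by force
    then show ?thesis by (simp add: T_def)
  qed
  have "0 = (\<Sum>i\<le>n. F ^ i * G ^ (n - i) * T i)"
    unfolding T_def sum_distrib_left ns(2)[symmetric] by (intro sum.cong refl) (simp add: mult_ac)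
  also have "\<dots> = (\<Sum>i\<in>{i0..n}. F ^ i * G ^ (n - i) * T i)"
    by (rule sum.mono_neutral_right) (auto simp: T0)
  also have "\<dots> = F ^ i0 * (\<Sum>i\<in>{i0..n}. F ^ (i - i0) * G ^ (n - i) * T i)"
    unfolding sum_distrib_left by (intro sum.cong refl) (simp add: mult.assoc[symmetric] flip: power_add)
  finally have "(\<Sum>i\<in>{i0..n}. F ^ (i - i0) * G ^ (n - i) * T i) = 0"
    using F(1) by (auto simp: prime_elem_def)
  also have "(\<Sum>i\<in>{i0..n}. F ^ (i - i0) * G ^ (n - i) * T i)
      = G ^ (n - i0) * T i0 + (\<Sum>i\<in>{i0<..n}. F ^ (i - i0) * G ^ (n - i) * T i)"
    using i0(1) by (subst sum.head) simp_all
  finally have "G ^ (n - i0) * T i0 = - (\<Sum>i\<in>{i0<..n}. F ^ (i - i0) * G ^ (n - i) * T i)"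
    by (simp add: eq_neg_iff_add_eq_0)
  moreover have "F dvd (\<Sum>i\<in>{i0<..n}. F ^ (i - i0) * G ^ (n - i) * T i)"
    by (intro dvd_sum) (auto simp: dvd_power)
  ultimately have "F dvd G ^ (n - i0) * T i0" by simp
  then have "F dvd T i0"
    using F(1,2) by (meson prime_elem_dvd_mult_iff prime_elem_dvd_power)
  define S where "S = (\<Sum>j\<le>n. monom (s i0 j) j)"
  have coeff_S: "coeff S j = (if j \<le> n then s i0 j else 0)" for j
    by (auto simp: S_def coeff_sum)
  then have "T i0 = form S n p q" by (simp add: T_def form_def)
  moreover have "S \<noteq> 0" using i0(2) coeff_S by (metis coeff_0)
  moreover have "degree S \<le> n" by (rule degree_le) (simp add: coeff_S)
  ultimately show ?thesis using prime_dvd_form_imp[OF F(1)] \<open>F dvd T i0\<close> by metis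
qed

section \<open>First integrals are rational functions of the pencil\<close>

text \<open>Generating the forms by multiplication with linear forms makes a linear change of F and
  G a plain induction.\<close>

inductive binary_form :: "bipoly \<Rightarrow> bipoly \<Rightarrow> nat \<Rightarrow> bipoly \<Rightarrow> bool" for F G where
  const: "binary_form F G 0 (bconst c)"
| linear_mult: "binary_form F G n u \<Longrightarrow> binary_form F G (Suc n) ((bconst a * F + bconst b * G) * u)"
| add: "binary_form F G n u \<Longrightarrow> binary_form F G n v \<Longrightarrow> binary_form F G n (u + v)"

lemma binary_form_bconst_mult: "binary_form F G n u \<Longrightarrow> binary_form F G n (bconst c * u)"
proof (induction rule: binary_form.induct)
  case (const c')
  show ?case using binary_form.const[of F G "c * c'"] by (simp add: bconst_mult)
next
  case (linear_mult n u a b)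
  then show ?case
    using binary_form.linear_mult[of F G n "bconst c * u" a b] by (simp add: mult_ac)
next
  case (add n u v)
  then show ?case
    using binary_form.add[of F G n "bconst c * u" "bconst c * v"] by (simp add: algebra_simps)
qed

lemma binary_form_diff:
  assumes "binary_form F G n u" "binary_form F G n v"
  shows "binary_form F G n (bconst a * u - bconst b * v)"
  using binary_form.add[OF binary_form_bconst_mult[OF assms(1), of a]
      binary_form_bconst_mult[OF assms(2), of "- b"]]
  by (simp add: bconst_minus)

lemma binary_form_change_basis:
  assumes "binary_form f g n u"
    "f = bconst a * F + bconst b * G" "g = bconst c * F + bconst d * G"
  shows "binary_form F G n u"
  using assms(1)
proof (induction rule: binary_form.induct)
  case (linear_mult n u r s)
  have "bconst r * f + bconst s * g = bconst (r * a + s * c) * F + bconst (r * b + s * d) * G"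
    unfolding assms(2,3) bconst_add bconst_mult by (simp only: algebra_simps)
  then show ?case
    using binary_form.linear_mult[OF linear_mult.IH, of "r * a + s * c" "r * b + s * d"] by simp
qed (auto intro: binary_form.intros)

text \<open>Separates the pure power of G from the terms divisible by F. The alternative
  \<open>w = 0\<close> covers n = 0, where no form of degree n - 1 exists.\<close>

lemma binary_form_split:
  assumes "binary_form F G n u"
  shows "\<exists>c w. u = bconst c * G ^ n + F * w \<and> (w = 0 \<or> (\<exists>k. n = Suc k \<and> binary_form F G k w))"
  using assms
proof (induction rule: binary_form.induct)
  case (const c)
  show ?case by (intro exI[of _ c] exI[of _ 0]) simp
next
  case (linear_mult n u a b)
  then obtain c w where cw: "u = bconst c * G ^ n + F * w"
    "w = 0 \<or> (\<exists>k. n = Suc k \<and> binary_form F G k w)" by blast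
  define w' where "w' = bconst a * u + bconst b * G * w"
  have "(bconst a * F + bconst b * G) * u = bconst a * F * u + bconst b * G * (bconst c * G ^ n + F * w)"
    unfolding cw(1)[symmetric] by (simp add: algebra_simps)
  then have "(bconst a * F + bconst b * G) * u = bconst (b * c) * G ^ Suc n + F * w'"
    unfolding w'_def bconst_mult by (simp add: algebra_simps)
  moreover have "binary_form F G n w'"
    using cw(2)
  proof
    assume "w = 0"
    then show ?thesis using binary_form_bconst_mult[OF linear_mult.hyps] by (simp add: w'_def)
  next
    assume "\<exists>k. n = Suc k \<and> binary_form F G k w"
    then obtain k where k: "n = Suc k" "binary_form F G k w" by blast
    from binary_form.linear_mult[OF k(2), of 0 b] k(1)
    have "binary_form F G n (bconst b * G * w)" by simp
    then show ?thesis
      unfolding w'_def by (intro binary_form.add binary_form_bconst_mult linear_mult.hyps)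
  qed
  ultimately show ?case by blast
next
  case (add n u v)
  then obtain c w c' w' where *: "u = bconst c * G ^ n + F * w"
    "w = 0 \<or> (\<exists>k. n = Suc k \<and> binary_form F G k w)"
    "v = bconst c' * G ^ n + F * w'"
    "w' = 0 \<or> (\<exists>k. n = Suc k \<and> binary_form F G k w')" by blast
  have "u + v = bconst (c + c') * G ^ n + F * (w + w')"
    unfolding *(1,3) bconst_add by (simp add: algebra_simps)
  moreover have "w + w' = 0 \<or> (\<exists>k. n = Suc k \<and> binary_form F G k (w + w'))"
    using *(2,4) binary_form.add by auto
  ultimately show ?case by blast
qed

text \<open>Splitting off F ends at a form with a nonzero pure power of G. Thus the order of u at
  each component of F = 0 outside G = 0 is a times the multiplicity of the component.\<close>

lemma binary_form_factor:
  assumes "binary_form F G n u" "u \<noteq> 0"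
  shows "\<exists>a u'. u = F ^ a * u' \<and> (\<forall>P. prime_elem P \<longrightarrow> P dvd F \<longrightarrow> \<not> P dvd G \<longrightarrow> \<not> P dvd u')"
  using assms
proof (induction n arbitrary: u rule: less_induct)
  case (less n)
  obtain c w where cw: "u = bconst c * G ^ n + F * w"
    "w = 0 \<or> (\<exists>k. n = Suc k \<and> binary_form F G k w)"
    using binary_form_split[OF less.prems(1)] by blast
  show ?case
  proof (cases "c = 0")
    case True
    then have "u = F * w" using cw(1) by simp
    then obtain k where "n = Suc k" "binary_form F G k w" "w \<noteq> 0"
      using cw(2) less.prems(2) by auto
    then obtain a u' where "w = F ^ a * u'"
      "\<forall>P. prime_elem P \<longrightarrow> P dvd F \<longrightarrow> \<not> P dvd G \<longrightarrow> \<not> P dvd u'"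
      using less.IH[of k w] by auto
    then show ?thesis
      using \<open>u = F * w\<close> by (intro exI[of _ "Suc a"] exI[of _ u']) (simp add: mult_ac)
  next
    case False
    have "\<not> P dvd u" if P: "prime_elem P" "P dvd F" "\<not> P dvd G" for P
    proof
      assume "P dvd u"
      moreover have "P dvd F * w" using P(2) by simp
      ultimately have "P dvd u - F * w" by (rule dvd_diff)
      then have "P dvd bconst c * G ^ n" using cw(1) by simp
      then have "P dvd bconst c \<or> P dvd G ^ n" using P(1) by (simp add: prime_elem_dvd_mult_iff)
      then show False
        using P is_unit_bconst[OF False] by (meson dvd_trans prime_elem_dvd_power prime_elem_not_unit)
    qed
    then show ?thesis by (intro exI[of _ 0] exI[of _ u]) simp
  qed
qed

lemma eq_0_of_infinite_prime_divisors:
  fixes x :: "'a :: factorial_semiring"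
  assumes "infinite E" "\<And>m. m \<in> E \<Longrightarrow> prime_elem (F m) \<and> F m dvd x"
    "\<And>m m'. m \<in> E \<Longrightarrow> m' \<in> E \<Longrightarrow> m \<noteq> m' \<Longrightarrow> \<not> F m dvd F m'"
  shows "x = 0"
proof (rule ccontr)
  assume "x \<noteq> 0"
  then have "(\<lambda>m. normalize (F m)) ` E \<subseteq> prime_factors x"
    using assms(2) by (auto simp: in_prime_factors_iff)
  then have "finite ((\<lambda>m. normalize (F m)) ` E)"
    by (rule finite_subset) simp
  moreover have "inj_on (\<lambda>m. normalize (F m)) E"
    by (rule inj_onI) (metis assms(3) associatedD1)
  ultimately show False using assms(1) finite_imageD by blast
qed

lemma prime_not_dvd_coprime:
  assumes "coprime f g" "prime_elem P" "P dvd f"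
  shows "\<not> P dvd g"
  using assms by (meson coprime_common_divisor prime_elem_not_unit)

text \<open>A first integral \<open>p / q\<close> is constant on each irreducible member of the pencil. If it takes
  different values on two of them, dividing them out of numerator and denominator (after a
  Moebius transformation) lowers the degree. Otherwise \<open>p / q\<close> is constant.\<close>

lemma (in derivation) first_integral_binary_forms:
  assumes t: "d t \<noteq> 0" and fg: "coprime f g" "d f = \<Lambda> * f" "d g = \<Lambda> * g"
    and E: "infinite E" "\<And>m. m \<in> E \<Longrightarrow> irreducible (f - bconst m * g)"
    and pq: "q \<noteq> 0" "d p * q = p * d q"
  shows "\<exists>n u v. binary_form f g n u \<and> binary_form f g n v \<and> v \<noteq> 0 \<and> p * v = q * u"
  using pq
proof (induction "max (tdeg p) (tdeg q)" arbitrary: p q rule: less_induct)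
  case less
  define F where "F = (\<lambda>m. f - bconst m * g)"
  have dF: "d (F m) = \<Lambda> * F m" for m
    unfolding F_def diff scale fg by (simp add: algebra_simps)
  have prF: "prime_elem (F m)" if "m \<in> E" for m
    using E(2)[OF that] unfolding F_def by (rule irreducible_imp_prime_elem)
  have F_g: "\<not> F m dvd g" if "m \<in> E" for m
  proof
    assume "F m dvd g"
    then have "F m dvd F m + bconst m * g" by simp
    then have "F m dvd f" by (simp add: F_def)
    then show False
      using prime_not_dvd_coprime[OF fg(1) prF[OF that]] \<open>F m dvd g\<close> by blast
  qed
  have F_F: "\<not> F m dvd F m'" if "m \<in> E" "m' \<in> E" "m \<noteq> m'" for m m'
  proof
    assume "F m dvd F m'"
    then have "F m dvd F m - F m'" by simp
    also have "F m - F m' = bconst (m' - m) * g"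
      by (simp add: F_def bconst_diff algebra_simps)
    finally show False
      using F_g[OF that(1)] is_unit_bconst[of "m' - m"] that(3) by (simp add: dvd_mult_unit_iff')
  qed
  have "\<exists>l r. (l \<noteq> 0 \<or> r \<noteq> 0) \<and> F m dvd bconst l * p - bconst r * q" if "m \<in> E" for m
    using first_integral_constant_on_curve[OF t prF[OF that] F_g[OF that] _ less.prems]
    by (simp add: dF fg mult_ac)
  \<comment> \<open>(r m : l m) is the value of p/q on the curve \<open>F m\<close> = 0.\<close>
  then obtain l r where lr: "\<And>m. m \<in> E \<Longrightarrow> l m \<noteq> 0 \<or> r m \<noteq> 0"
    "\<And>m. m \<in> E \<Longrightarrow> F m dvd bconst (l m) * p - bconst (r m) * q"
    by metis
  define h where "h = (\<lambda>m. bconst (l m) * p - bconst (r m) * q)"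
  have F_h: "F m dvd h m" if "m \<in> E" for m
    using lr(2)[OF that] by (simp add: h_def)
  have const: ?case if "m \<in> E" "h m = 0" for m
  proof -
    have eq: "bconst (l m) * p = bconst (r m) * q" using that(2) by (simp add: h_def)
    then have "l m \<noteq> 0" using lr(1)[OF that(1)] less.prems(1) by auto
    show ?thesis
    proof (intro exI conjI)
      show "p * bconst (l m) = q * bconst (r m)" using eq by (simp add: mult_ac)
      show "bconst (l m) \<noteq> 0" using \<open>l m \<noteq> 0\<close> by simp
    qed (rule binary_form.const)+
  qed
  show ?case
  proof (cases "\<exists>m\<in>E. \<exists>m'\<in>E. l m * r m' - l m' * r m \<noteq> 0")
    case False
    obtain m0 where m0: "m0 \<in> E" using E(1) by fastforce
    \<comment> \<open>All values agree, so the single polynomial \<open>h m0\<close> is divisible by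
      infinitely many pairwise nonassociated primes.\<close>
    have "F m dvd h m0" if "m \<in> E" for m
    proof -
      have det: "l m * r m0 = l m0 * r m" using False that m0 by (metis right_minus_eq)
      have eq: "bconst (l m0) * h m = bconst (l m) * h m0" "bconst (r m0) * h m = bconst (r m) * h m0"
        using arg_cong[OF det, of bconst] unfolding h_def bconst_mult
        by (simp_all add: algebra_simps)
      have "F m dvd bconst (l m) * h m0" "F m dvd bconst (r m) * h m0"
        unfolding eq[symmetric] using F_h[OF that] by simp_all
      then show ?thesis
        using lr(1)[OF that] is_unit_bconst by (metis dvd_mult_unit_iff')
    qed
    then have "h m0 = 0"
      using prF F_F by (intro eq_0_of_infinite_prime_divisors[OF E(1), of F]) blast+
    then show ?thesis by (rule const[OF m0])
  next
    case True
    then obtain m m' where m: "m \<in> E" "m' \<in> E" and det: "l m * r m' - l m' * r m \<noteq> 0" by blast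
    show ?thesis
    proof (cases "h m = 0 \<or> h m' = 0")
      case True
      then show ?thesis by (rule disjE[OF _ const[OF m(1)] const[OF m(2)]])
    next
      case False
      \<comment> \<open>\<open>h m / h m'\<close> is a Moebius transform of p/q, and
        \<open>F m / F m'\<close> is a first integral because both have cofactor \<Lambda>. Hence
        p1/q1 is a first integral too.\<close>
      obtain p1 q1 where pq1: "h m = F m * p1" "h m' = F m' * q1"
        using F_h m by (meson dvdE)
      then have nz: "p1 \<noteq> 0" "q1 \<noteq> 0" "F m \<noteq> 0" "F m' \<noteq> 0" using False by auto
      have le: "tdeg (h k) \<le> max (tdeg p) (tdeg q)" for k
        unfolding h_def
        using tdeg_diff_le[of "bconst (l k) * p" "bconst (r k) * q"]
          tdeg_bconst_mult_le[of "l k" p] tdeg_bconst_mult_le[of "r k" q] by linarith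
      have "tdeg (F m) > 0" "tdeg (F m') > 0"
        using E(2) m unfolding F_def by (auto intro: irreducible_tdeg_pos)
      then have small: "max (tdeg p1) (tdeg q1) < max (tdeg p) (tdeg q)"
        using le[of m] le[of m'] nz unfolding pq1 by (auto simp: tdeg_mult)
      have "d (h m) * h m' = h m * d (h m')"
      proof -
        have "d (h m) * h m' - h m * d (h m') = bconst (l m' * r m - l m * r m') * (d p * q - p * d q)"
          unfolding h_def diff scale bconst_diff bconst_mult by (simp add: algebra_simps)
        then show ?thesis using less.prems(2) by simp
      qed
      then have "(F m * F m') * (d p1 * q1) = (F m * F m') * (p1 * d q1)"
        unfolding pq1 mult dF by (simp add: algebra_simps)
      then have "d p1 * q1 = p1 * d q1" using nz by simp
      then obtain n u v where uv: "binary_form f g n u" "binary_form f g n v" "v \<noteq> 0" "p1 * v = q1 * u"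
        using less.hyps[OF small nz(2)] by blast
      \<comment> \<open>Solving \<open>h m * F m' * v = h m' * F m * u\<close> for p/q gives u'/v';
        the nonzero determinant keeps \<open>v'\<close> from vanishing.\<close>
      define v' where "v' = bconst (l m) * (F m' * v) - bconst (l m') * (F m * u)"
      define u' where "u' = bconst (r m) * (F m' * v) - bconst (r m') * (F m * u)"
      have F_bf: "binary_form f g (Suc n) (F k * w)" if "binary_form f g n w" for k w
        using binary_form.linear_mult[OF that, of 1 "- k"] by (simp add: F_def bconst_minus)
      have bf: "binary_form f g (Suc n) v'" "binary_form f g (Suc n) u'"
        unfolding v'_def u'_def by (intro binary_form_diff F_bf uv)+
      have "q1 * (h m * (F m' * v)) = q1 * (h m' * (F m * u))"
        unfolding pq1 using arg_cong[OF uv(4), of "\<lambda>x. F m * F m' * q1 * x"] by (simp add: mult_ac)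
      then have "h m * (F m' * v) = h m' * (F m * u)" using nz by simp
      then have eq: "p * v' = q * u'"
        unfolding h_def v'_def u'_def by (simp add: algebra_simps)
      have "v' \<noteq> 0"
      proof
        assume "v' = 0"
        then have "u' = 0" using eq less.prems(1) by simp
        have "bconst (l m * r m' - l m' * r m) * (F m' * v) = bconst (r m') * v' - bconst (l m') * u'"
          unfolding v'_def u'_def bconst_diff bconst_mult by (simp add: algebra_simps)
        then show False using \<open>v' = 0\<close> \<open>u' = 0\<close> det nz uv(3) by simp
      qed
      then show ?thesis using bf eq by blast
    qed
  qed
qed

section \<open>Independence of the cofactors of non-pivot factors\<close>

text \<open>For differential forms: every polynomial 1-form that vanishes on D is a multiple of B dX
  - A dY.\<close>

lemma coprime_syzygy:
  fixes A B :: "'a :: {idom_divide, semiring_gcd}"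
  assumes "coprime A B" "A * U + B * U' = 0"
  obtains W where "U = B * W" "U' = - (A * W)"
proof (cases "B = 0")
  case True
  then have "is_unit A" using assms(1) by simp
  then obtain k where "U' = A * k" by (meson unit_imp_dvd dvdE)
  moreover have "A \<noteq> 0" using \<open>is_unit A\<close> by auto
  then have "U = 0" using assms(2) True by simp
  ultimately show ?thesis using that[of "- k"] True by simp
next
  case False
  have "A * U = B * (- U')" using assms(2) by (simp add: eq_neg_iff_add_eq_0)
  then have "B dvd A * U" by (metis dvd_triv_left)
  then have "B dvd U" using assms(1) by (simp add: coprime_commute coprime_dvd_mult_right_iff)
  then obtain W where W: "U = B * W" ..
  have "B * (A * W + U') = 0" using assms(2) unfolding W by (simp add: algebra_simps)
  then have "U' = - (A * W)" using False by (simp add: eq_neg_iff_add_eq_0 add.commute)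
  then show ?thesis using that W by blast
qed

lemma dvd_of_dvd_coprime_mults:
  fixes A B :: "'a :: semiring_gcd"
  assumes "coprime A B" "x dvd A * W" "x dvd B * W"
  shows "x dvd W"
proof -
  have "x dvd gcd (W * A) (W * B)" using assms(2,3) by (simp add: mult.commute)
  also have "gcd (W * A) (W * B) = normalize W"
    using assms(1) by (simp add: gcd_mult_left coprime_iff_gcd_eq_1)
  finally show ?thesis by simp
qed

text \<open>The form \<omega> = \<Sum> c_P dP/P times \<Prod>K: \<open>dX\<close> in place of d
  gives its X-coefficient, \<open>dY\<close> its Y-coefficient.\<close>

definition log_form :: "(bipoly \<Rightarrow> complex) \<Rightarrow> bipoly set \<Rightarrow> (bipoly \<Rightarrow> bipoly) \<Rightarrow> bipoly" where
  "log_form c K d = (\<Sum>P\<in>K. bconst (c P) * \<Prod>(K - {P}) * d P)"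

lemma log_form_insert:
  assumes "finite K" "P \<notin> K"
  shows "log_form c (insert P K) d = bconst (c P) * \<Prod>K * d P + P * log_form c K d"
proof -
  have "bconst (c Q) * \<Prod>(insert P K - {Q}) * d Q = P * (bconst (c Q) * \<Prod>(K - {Q}) * d Q)"
    if "Q \<in> K" for Q
  proof -
    have "insert P K - {Q} = insert P (K - {Q})" using that assms(2) by auto
    then show ?thesis using assms by (simp add: mult_ac)
  qed
  then have "(\<Sum>Q\<in>K. bconst (c Q) * \<Prod>(insert P K - {Q}) * d Q) = P * log_form c K d"
    unfolding log_form_def sum_distrib_left by (intro sum.cong refl)
  moreover have "insert P K - {P} = K" using assms(2) by auto
  ultimately show ?thesis
    unfolding log_form_def[of c "insert P K"] by (simp only: sum.insert[OF assms])
qed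

text \<open>With \<open>Q = \<Prod>K\<close>, this says \<open>d(\<Sum> c\<^sub>P dP/P) = 0\<close>, multiplied by \<open>Q\<^sup>2\<close>.\<close>

lemma log_form_closed:
  assumes "finite K"
  shows "\<Prod>K * (dY (log_form c K dX) - dX (log_form c K dY))
    = log_form c K dX * dY (\<Prod>K) - log_form c K dY * dX (\<Prod>K)"
  using assms
proof (induction K rule: finite_induct)
  case empty
  then show ?case by (simp add: log_form_def)
next
  case (insert P K)
  define a b Q where "a = log_form c K dX" and "b = log_form c K dY" and "Q = \<Prod>K"
  have IH: "Q * (dY a - dX b) = a * dY Q - b * dX Q"
    using insert.IH by (simp add: a_def b_def Q_def)
  have "\<Prod>(insert P K) = P * Q" using insert by (simp add: Q_def)
  moreover have "P * Q * (dY (bconst (c P) * Q * dX P + P * a) - dX (bconst (c P) * Q * dY P + P * b))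
    = (bconst (c P) * Q * dX P + P * a) * dY (P * Q) - (bconst (c P) * Q * dY P + P * b) * dX (P * Q)"
    unfolding dX_add dY_add dX_mult dY_mult dX_bconst dY_bconst dX_dY using IH by algebra
  ultimately show ?case
    by (simp add: log_form_insert[OF insert.hyps] a_def b_def Q_def)
qed

text \<open>Contracting \<omega> with D turns dP/P into the cofactor \<open>L P\<close>.\<close>

lemma log_form_syzygy:
  assumes "\<And>P. P \<in> K \<Longrightarrow> deriv2 A B P = L P * P" "finite K"
  shows "A * log_form c K dX + B * log_form c K dY = \<Prod>K * (\<Sum>P\<in>K. bconst (c P) * L P)"
proof -
  have "A * (bconst (c P) * \<Prod>(K - {P}) * dX P) + B * (bconst (c P) * \<Prod>(K - {P}) * dY P)
    = \<Prod>K * (bconst (c P) * L P)" if "P \<in> K" for P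
  proof -
    have "A * (bconst (c P) * \<Prod>(K - {P}) * dX P) + B * (bconst (c P) * \<Prod>(K - {P}) * dY P)
      = bconst (c P) * \<Prod>(K - {P}) * deriv2 A B P"
      by (simp add: deriv2_def algebra_simps)
    also have "\<dots> = bconst (c P) * (P * \<Prod>(K - {P})) * L P"
      unfolding assms(1)[OF that] by (simp add: mult_ac)
    also have "P * \<Prod>(K - {P}) = \<Prod>K"
      using prod.remove[OF assms(2) that, of "\<lambda>x. x"] by simp
    finally show ?thesis by (simp add: mult_ac)
  qed
  then show ?thesis
    unfolding log_form_def sum_distrib_left sum.distrib[symmetric] by (intro sum.cong) auto
qed

text \<open>G dF - F dG is G^2 d(F/G); this is the closedness of d(F/G), in the shape of
  \<open>log_form_closed\<close> with denominator G * G.\<close>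

lemma pencil_form_closed:
  "(G * G) * (dY (G * dX F - F * dX G) - dX (G * dY F - F * dY G))
    = (G * dX F - F * dX G) * dY (G * G) - (G * dY F - F * dY G) * dX (G * G)"
  unfolding dX.diff dY.diff dX_mult dY_mult dX_dY by algebra

text \<open>Closedness of (V/Q)(B dX - A dY) is the equation D(V/Q) + div(D) V/Q = 0, here
  multiplied by Q^2.\<close>

lemma integrating_factor:
  assumes "Q * (dY a - dX b) = a * dY Q - b * dX Q" "a = B * V" "b = - (A * V)"
  shows "Q * (deriv2 A B V + (dX A + dY B) * V) = V * deriv2 A B Q"
  using assms(1) unfolding assms(2,3) deriv2_def dX.minus dX_mult dY_mult by algebra

text \<open>Each hypothesis says \<open>D(V/Q) = - e V/Q\<close>.\<close>

lemma integrating_factors_quotient: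
  assumes "Q1 * (deriv2 A B V1 + e * V1) = V1 * deriv2 A B Q1"
    "Q2 * (deriv2 A B V2 + e * V2) = V2 * deriv2 A B Q2"
  shows "deriv2 A B (V1 * Q2) * (Q1 * V2) = (V1 * Q2) * deriv2 A B (Q1 * V2)"
  using assms unfolding deriv2_mult by algebra

text \<open>With \<open>F = P ^ Suc k * R\<close>, the form G dF - F dG is \<open>P ^ k\<close>
  times (k + 1) G R dP plus a multiple of P. As P does not divide both of its partials, the order at
  P is exactly k; coprimality of A and B passes it on to W.\<close>

lemma multiplicity_pencil_form:
  assumes P: "prime_elem P" "P dvd F" "\<not> P dvd G" and "F \<noteq> 0" "coprime A B"
    and W: "G * dX F - F * dX G = B * W" "G * dY F - F * dY G = - (A * W)"
  shows "W \<noteq> 0" "multiplicity P F = Suc (multiplicity P W)"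
proof -
  have nu: "\<not> is_unit P" "P \<noteq> 0" using P(1) by (auto simp: prime_elem_def)
  obtain R where R: "F = P ^ multiplicity P F * R" "\<not> P dvd R"
    using multiplicity_decompose'[OF \<open>F \<noteq> 0\<close> nu(1)] by blast
  have "multiplicity P F \<noteq> 0" using P(2) \<open>F \<noteq> 0\<close> nu by (simp add: multiplicity_eq_zero_iff)
  then obtain k where k: "multiplicity P F = Suc k" by (cases "multiplicity P F") auto
  have F: "F = P ^ Suc k * R" using R(1) unfolding k .
  have expand: "G * d F - F * d G =
      P ^ k * (bconst (of_nat (Suc k)) * G * R * d P + P * (G * d R - R * d G))"
    if "derivation d" for d
    unfolding F derivation.mult[OF that] derivation.power_Suc[OF that] of_nat_bipoly
    by (simp add: algebra_simps)
  have dX: "derivation dX" and dY: "derivation dY"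
    by (rule dX.derivation_axioms) (rule dY.derivation_axioms)
  have "P ^ k dvd B * W" "P ^ k dvd - (A * W)"
    unfolding W[symmetric] expand[OF dX] expand[OF dY] by (rule dvd_triv_left)+
  then have "P ^ k dvd W"
    unfolding dvd_minus_iff using dvd_of_dvd_coprime_mults[OF \<open>coprime A B\<close>] by blast
  then obtain W1 where W1: "W = P ^ k * W1" ..
  have eq: "B * W1 = bconst (of_nat (Suc k)) * G * R * dX P + P * (G * dX R - R * dX G)"
    "- (A * W1) = bconst (of_nat (Suc k)) * G * R * dY P + P * (G * dY R - R * dY G)"
  proof -
    have "P ^ k * (B * W1) = P ^ k * (bconst (of_nat (Suc k)) * G * R * dX P + P * (G * dX R - R * dX G))"
      using W(1)[symmetric] unfolding expand[OF dX] W1 by (simp only: mult.left_commute)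
    then show "B * W1 = bconst (of_nat (Suc k)) * G * R * dX P + P * (G * dX R - R * dX G)"
      using nu(2) by (metis mult_left_cancel power_not_zero)
    have "P ^ k * - (A * W1) = P ^ k * (bconst (of_nat (Suc k)) * G * R * dY P + P * (G * dY R - R * dY G))"
      using W(2)[symmetric] unfolding expand[OF dY] W1 by (simp only: mult.left_commute mult_minus_right)
    then show "- (A * W1) = bconst (of_nat (Suc k)) * G * R * dY P + P * (G * dY R - R * dY G)"
      using nu(2) by (metis mult_left_cancel power_not_zero)
  qed
  have dvd_d: "P dvd D" if "P dvd Z" "Z = bconst (of_nat (Suc k)) * G * R * D + P * T" for D T Z
  proof -
    have "P dvd bconst (of_nat (Suc k)) * G * R * D"
      using that by (metis dvd_add_left_iff dvd_triv_left)
    then have "P dvd bconst (of_nat (Suc k)) \<or> P dvd D"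
      using P(1,3) R(2) by (simp add: prime_elem_dvd_mult_iff)
    moreover have "is_unit (bconst (of_nat (Suc k)))"
      by (rule is_unit_bconst) (simp del: of_nat_Suc)
    ultimately show ?thesis using nu(1) dvd_trans by blast
  qed
  have "\<not> P dvd W1"
  proof
    assume "P dvd W1"
    then have "P dvd dX P" "P dvd dY P"
      using dvd_d[OF _ eq(1)] dvd_d[OF _ eq(2)] by simp_all
    then show False
      using not_dvd_both_partials[of P] P(1) by (simp add: prime_elem_imp_irreducible)
  qed
  moreover from this show "W \<noteq> 0" using W1 nu(2) by auto
  ultimately show "multiplicity P F = Suc (multiplicity P W)"
    using nu P(1) unfolding k W1
    by (subst prime_elem_multiplicity_mult_distrib)
      (auto simp: multiplicity_same_power not_dvd_imp_multiplicity_0)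
qed

text \<open>A vanishing member would make the coprime f and g proportional, hence constant, and then
  no member could be irreducible.\<close>

lemma pencil_member_nonzero:
  assumes "coprime f g" "irreducible (f - bconst k * g)" "l \<noteq> 0 \<or> m \<noteq> 0"
  shows "bconst l * f - bconst m * g \<noteq> 0"
proof
  assume *: "bconst l * f - bconst m * g = 0"
  show False
  proof (cases "l = 0")
    case True
    then have "g = 0" using * assms(3) by simp
    then show False using assms(1,2) by (simp add: irreducible_def)
  next
    case False
    have "bconst l * f = bconst m * g" using * by simp
    then have "f = bconst (inverse l) * (bconst m * g)"
      using False by (metis bconst_1 bconst_mult left_inverse mult.assoc mult_1)
    then have f: "f = bconst (inverse l * m) * g" by (simp add: bconst_mult mult.assoc)
    then have "is_unit g" using assms(1) by (metis coprime_common_divisor dvd_refl dvd_triv_right)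
    then obtain e where "g = bconst e" by (auto simp: is_unit_bipoly_iff)
    then have "f - bconst k * g = bconst (inverse l * m * e - k * e)"
      unfolding f by (simp add: bconst_diff bconst_mult)
    then show False using irreducible_tdeg_pos[OF assms(2)] by simp
  qed
qed

text \<open>In \<open>fiber\<close>, r is the pivot of the member containing P. The first integral h
  is V G^2 / (Q W), and its orders at p and at r cannot both be the same multiple of the
  multiplicities in F.\<close>

lemma cofactors_independent:
  assumes AB: "coprime A B" and fg: "coprime f g" "deriv2 A B f = \<Lambda> * f" "deriv2 A B g = \<Lambda> * g"
    and E: "infinite E" "\<And>m. m \<in> E \<Longrightarrow> irreducible (f - bconst m * g)"
    and J: "finite J" "\<And>P. P \<in> J \<Longrightarrow> prime P" "\<And>P. P \<in> J \<Longrightarrow> deriv2 A B P = L P * P"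
    and fiber: "\<And>P. P \<in> J \<Longrightarrow> \<exists>l m r. (l \<noteq> 0 \<or> m \<noteq> 0) \<and> prime r \<and> r \<notin> J
      \<and> P dvd bconst l * f - bconst m * g \<and> r dvd bconst l * f - bconst m * g"
    and rel: "(\<Sum>P\<in>J. bconst (c P) * L P) = 0" and "p \<in> J"
  shows "c p = 0"
proof (rule ccontr)
  assume c1: "c p \<noteq> 0"
  define K where "K = {P \<in> J. c P \<noteq> 0}"
  have K: "finite K" "K \<subseteq> J" "p \<in> K" using J(1) \<open>p \<in> J\<close> c1 by (auto simp: K_def)
  have "(\<Sum>P\<in>K. bconst (c P) * L P) = (\<Sum>P\<in>J. bconst (c P) * L P)"
    using J(1) by (intro sum.mono_neutral_left) (auto simp: K_def)
  then have "A * log_form c K dX + B * log_form c K dY = 0"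
    using log_form_syzygy[of K A B L c] J(3) K rel by auto
  then obtain V where V: "log_form c K dX = B * V" "log_form c K dY = - (A * V)"
    using coprime_syzygy[OF AB] by blast
  obtain l m r where lm: "l \<noteq> 0 \<or> m \<noteq> 0" and r: "prime r" "r \<notin> J"
    and dvdF: "p dvd bconst l * f - bconst m * g" "r dvd bconst l * f - bconst m * g"
    using fiber[OF \<open>p \<in> J\<close>] by blast
  \<comment> \<open>A second member G completes F to a basis of the pencil, so that the fiber of p
    becomes F = 0.\<close>
  obtain l' m' where det: "l * m' - l' * m \<noteq> 0"
    using lm by (metis diff_0 diff_zero mult_1 mult_1_right mult_zero_left mult_zero_right neg_equal_0_iff_equal)
  define F G where "F = bconst l * f - bconst m * g" and "G = bconst l' * f - bconst m' * g"
  define e where "e = inverse (l * m' - l' * m)"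
  have basis: "f = bconst (e * m') * F + bconst (- (e * m)) * G"
    "g = bconst (e * l') * F + bconst (- (e * l)) * G"
  proof -
    have e: "bconst e * bconst (l * m' - l' * m) = 1"
      using det by (simp add: e_def flip: bconst_mult)
    show "f = bconst (e * m') * F + bconst (- (e * m)) * G"
      "g = bconst (e * l') * F + bconst (- (e * l)) * G"
      using e unfolding F_def G_def bconst_minus bconst_mult bconst_diff by algebra+
  qed
  have "F \<noteq> 0"
  proof -
    obtain k where "k \<in> E" using E(1) by fastforce
    then show ?thesis
      unfolding F_def using pencil_member_nonzero[OF fg(1) E(2) lm] by blast
  qed
  have not_G: "\<not> P dvd G" if "prime_elem P" "P dvd F" for P
  proof
    assume "P dvd G"
    then have "P dvd f" "P dvd g" using that(2) by (subst basis, simp)+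
    then show False using prime_not_dvd_coprime[OF fg(1) that(1)] by blast
  qed
  have dF: "deriv2 A B F = \<Lambda> * F" and dG: "deriv2 A B G = \<Lambda> * G"
    unfolding F_def G_def deriv2.diff deriv2.scale fg(2,3) by (simp_all add: algebra_simps)
  have "A * (G * dX F - F * dX G) + B * (G * dY F - F * dY G) = G * deriv2 A B F - F * deriv2 A B G"
    by (simp add: deriv2_def algebra_simps)
  also have "\<dots> = 0" by (simp add: dF dG)
  finally obtain W where W: "G * dX F - F * dX G = B * W" "G * dY F - F * dY G = - (A * W)"
    using coprime_syzygy[OF AB] by blast
  have pr: "prime_elem p" "prime_elem r" using J(2)[OF \<open>p \<in> J\<close>] r(1) by auto
  have P_F: "p dvd F" "r dvd F" using dvdF by (auto simp: F_def)
  note G1 = not_G[OF pr(1) P_F(1)] and G0 = not_G[OF pr(2) P_F(2)]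
  note W1 = multiplicity_pencil_form[OF pr(1) P_F(1) G1 \<open>F \<noteq> 0\<close> AB W]
  note W0 = multiplicity_pencil_form[OF pr(2) P_F(2) G0 \<open>F \<noteq> 0\<close> AB W]
  define Q where "Q = \<Prod>K"
  define Q1 where "Q1 = \<Prod>(K - {p})"
  have Q: "Q = p * Q1"
    using prod.remove[OF K(1,3), of "\<lambda>x. x"] by (simp add: Q_def Q1_def)
  have not_prod: "\<not> P dvd \<Prod>T" if T: "prime P" "P \<notin> T" "T \<subseteq> J" for P T
  proof
    assume "P dvd \<Prod>T"
    moreover have "finite T" using T(3) J(1) by (rule finite_subset)
    ultimately obtain R where "R \<in> T" "P dvd R"
      using T(1) prime_dvd_prod_iff[of T P "\<lambda>x. x"] by blast
    then show False using T J(2) primes_dvd_imp_eq by blast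
  qed
  have p_Q1: "\<not> p dvd Q1"
    unfolding Q1_def using K J(2) by (intro not_prod) auto
  have r_Q: "\<not> r dvd Q"
    unfolding Q_def using K r by (intro not_prod) auto
  then have "Q \<noteq> 0" by auto
  \<comment> \<open>The pole at p is genuine: modulo p only the term \<open>c p * Q1 * d p\<close>
    of the logarithmic form survives.\<close>
  have p_V: "\<not> p dvd V"
  proof
    assume "p dvd V"
    have K_ins: "K = insert p (K - {p})" using K(3) by auto
    have ins: "log_form c K d = bconst (c p) * Q1 * d p + p * log_form c (K - {p}) d" for d
      by (subst K_ins, subst log_form_insert) (use K in \<open>auto simp: Q1_def\<close>)
    have "p dvd d p" if "p dvd log_form c K d" for d
    proof -
      have "p dvd bconst (c p) * Q1 * d p"
        using that unfolding ins by (metis dvd_add_left_iff dvd_triv_left)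
      then have "p dvd bconst (c p) \<or> p dvd d p"
        using pr(1) p_Q1 by (simp add: prime_elem_dvd_mult_iff)
      then show ?thesis
        using is_unit_bconst[OF c1] pr(1) by (meson dvd_trans prime_elem_not_unit)
    qed
    then have "p dvd dX p" "p dvd dY p"
      using V \<open>p dvd V\<close> by auto
    then show False
      using not_dvd_both_partials[of p] pr(1) by (simp add: prime_elem_imp_irreducible)
  qed
  then have "V \<noteq> 0" by auto
  have "G \<noteq> 0" using G1 by auto
  \<comment> \<open>V/Q and W/G^2 are integrating factors of the same form B dX - A dY, so their
    quotient h is a first integral.\<close>
  have "deriv2 A B (V * (G * G)) * (Q * W) = V * (G * G) * deriv2 A B (Q * W)"
  proof (rule integrating_factors_quotient)
    show "Q * (deriv2 A B V + (dX A + dY B) * V) = V * deriv2 A B Q"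
      using log_form_closed[OF K(1)] V unfolding Q_def by (rule integrating_factor)
    show "G * G * (deriv2 A B W + (dX A + dY B) * W) = W * deriv2 A B (G * G)"
      using pencil_form_closed W by (rule integrating_factor)
  qed
  \<comment> \<open>X or Y serves as t; D kills at most one of them because coprime A and B are not
    both 0.\<close>
  moreover obtain t where "deriv2 A B t \<noteq> 0"
  proof (cases "A = 0")
    case False
    have "deriv2 A B [:[:0, 1:]:] = A"
      by (simp add: deriv2_def dX_def dY_def map_poly_pCons pderiv_pCons flip: one_pCons)
    then show ?thesis using that False by metis
  next
    case True
    then have "B \<noteq> 0" using AB by auto
    moreover have "deriv2 A B [:0, 1:] = B"
      by (simp add: deriv2_def True dY_def pderiv_pCons flip: one_pCons)
    ultimately show ?thesis using that by metis
  qed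
  ultimately obtain n u v where uv: "binary_form f g n u" "binary_form f g n v" "v \<noteq> 0"
    "V * (G * G) * v = Q * W * u"
    using deriv2.first_integral_binary_forms[of A B t f g \<Lambda> E "Q * W" "V * (G * G)"]
      fg E \<open>Q \<noteq> 0\<close> W1(1) by auto
  have "u \<noteq> 0" using uv(3,4) \<open>V \<noteq> 0\<close> \<open>G \<noteq> 0\<close> by auto
  obtain a u' where u': "u = F ^ a * u'" "\<And>P. prime_elem P \<Longrightarrow> P dvd F \<Longrightarrow> \<not> P dvd u'"
    using binary_form_factor[OF binary_form_change_basis[OF uv(1) basis] \<open>u \<noteq> 0\<close>] not_G by blast
  obtain b v' where v': "v = F ^ b * v'" "\<And>P. prime_elem P \<Longrightarrow> P dvd F \<Longrightarrow> \<not> P dvd v'"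
    using binary_form_factor[OF binary_form_change_basis[OF uv(2) basis] uv(3)] not_G by blast
  have nz: "u' \<noteq> 0" "v' \<noteq> 0" using u'(1) v'(1) \<open>u \<noteq> 0\<close> uv(3) by auto
  \<comment> \<open>Orders at a component P of F = 0 in V G^2 v = Q W u; G, \<open>u'\<close> and
    \<open>v'\<close> contribute nothing.\<close>
  have mult: "multiplicity P V + b * multiplicity P F = multiplicity P Q + multiplicity P W + a * multiplicity P F"
    if P: "prime_elem P" "P dvd F" for P
  proof -
    have "multiplicity P (V * (G * G) * (F ^ b * v')) = multiplicity P V + b * multiplicity P F"
      using P \<open>V \<noteq> 0\<close> \<open>G \<noteq> 0\<close> \<open>F \<noteq> 0\<close> nz
      by (simp add: prime_elem_multiplicity_mult_distrib prime_elem_multiplicity_power_distrib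
          not_dvd_imp_multiplicity_0 not_G v'(2))
    moreover have "multiplicity P (Q * W * (F ^ a * u')) = multiplicity P Q + multiplicity P W + a * multiplicity P F"
      using P \<open>Q \<noteq> 0\<close> W1(1) \<open>F \<noteq> 0\<close> nz
      by (simp add: prime_elem_multiplicity_mult_distrib prime_elem_multiplicity_power_distrib
          not_dvd_imp_multiplicity_0 u'(2))
    ultimately show ?thesis using uv(4) unfolding u'(1) v'(1) by simp
  qed
  have "multiplicity p Q = 1"
    unfolding Q using pr(1) p_Q1
    by (subst multiplicity_times_same) (auto simp: not_dvd_imp_multiplicity_0 prime_elem_def)
  then have "b * multiplicity p F = (a + 1) * multiplicity p F"
    using mult[OF pr(1) P_F(1)] W1(2) by (simp add: not_dvd_imp_multiplicity_0[OF p_V])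
  then have "b = a + 1" unfolding mult_cancel2 using W1(2) by auto
  \<comment> \<open>At p the simple pole and the order of W, one below that of F, give b = a + 1. At
    the pivot there is no pole, so one unit is missing.\<close>
  moreover have "b * multiplicity r F < (a + 1) * multiplicity r F"
    using mult[OF pr(2) P_F(2)] W0(2) by (simp add: not_dvd_imp_multiplicity_0[OF r_Q])
  ultimately show False by simp
qed

text \<open>If \<open>F = P ^ Suc k * R\<close>, then d F equals (k + 1) \<open>P ^ k\<close> R d P
  modulo \<open>P ^ Suc k\<close>. Since d F is a multiple of F, P divides d P.\<close>

lemma (in derivation) prime_factor_dvd_derivative:
  assumes "prime_elem P" "P dvd F" "F \<noteq> 0" "d F = \<Lambda> * F"
  shows "P dvd d P"
proof -
  have nu: "\<not> is_unit P" "P \<noteq> 0" using assms(1) by (auto simp: prime_elem_def)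
  obtain R where R: "F = P ^ multiplicity P F * R" "\<not> P dvd R"
    using multiplicity_decompose'[OF \<open>F \<noteq> 0\<close> nu(1)] by blast
  have "multiplicity P F \<noteq> 0" using assms(2,3) nu by (simp add: multiplicity_eq_zero_iff)
  then obtain k where k: "multiplicity P F = Suc k" by (cases "multiplicity P F") auto
  have F: "F = P ^ Suc k * R" using R(1) unfolding k .
  have "P ^ k * (bconst (of_nat (Suc k)) * R * d P) = P ^ k * (P * (\<Lambda> * R - d R))"
    using assms(4) unfolding F mult power_Suc of_nat_bipoly by (simp add: algebra_simps)
  then have "bconst (of_nat (Suc k)) * R * d P = P * (\<Lambda> * R - d R)"
    using nu(2) by (metis mult_left_cancel power_not_zero)
  then have "P dvd bconst (of_nat (Suc k)) * R * d P" by simp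
  then have "P dvd bconst (of_nat (Suc k)) \<or> P dvd d P"
    using assms(1) R(2) by (simp add: prime_elem_dvd_mult_iff)
  moreover have "is_unit (bconst (of_nat (Suc k)))"
    by (rule is_unit_bconst) (simp del: of_nat_Suc)
  ultimately show ?thesis using nu(1) dvd_trans by blast
qed

section \<open>The bound on the total order of reducibility\<close>

definition pencil_member :: "bipoly \<Rightarrow> bipoly \<Rightarrow> complex \<times> complex \<Rightarrow> bipoly" where
  "pencil_member f g s = bconst (fst s) * f - bconst (snd s) * g"

lemma pencil_eq_homog:
  "pencil f g l m = homog (max (tdeg f) (tdeg g)) (pencil_member f g (l, m))"
proof -
  define d where "d = max (tdeg f) (tdeg g)"
  have diff: "eval3 (p - q) x y z = eval3 p x y z - eval3 q x y z" for p q x y z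
    by (simp add: eval3_def eval2_def)
  have "tdeg (pencil_member f g (l, m)) \<le> d"
    unfolding pencil_member_def d_def using tdeg_diff_le[of "bconst l * f" "bconst m * g"]
      tdeg_bconst_mult_le[of l f] tdeg_bconst_mult_le[of m g] by simp
  moreover have "eval3 (tconst l * homog d f - tconst m * homog d g) (x * z) (y * z) z
      = z ^ d * eval2 (pencil_member f g (l, m)) x y" for x y z
  proof -
    have *: "eval2 (pencil_member f g (l, m)) x y = l * eval2 f x y - m * eval2 g x y"
      by (simp add: pencil_member_def eval2_def bconst_def)
    show ?thesis
      unfolding * by (simp add: diff eval3_mult eval3_homog d_def algebra_simps)
  qed
  ultimately show ?thesis
    unfolding pencil_def Let_def d_def[symmetric] by (intro homog_eqI[symmetric]) auto
qed

lemma pencil_member_basis: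
  assumes "fst s * snd s' - fst s' * snd s \<noteq> 0"
  obtains a b a' b' where "f = bconst a * pencil_member f g s + bconst b * pencil_member f g s'"
    "g = bconst a' * pencil_member f g s + bconst b' * pencil_member f g s'"
proof -
  define e where "e = inverse (fst s * snd s' - fst s' * snd s)"
  have e: "bconst e * bconst (fst s * snd s' - fst s' * snd s) = 1"
    using assms by (simp add: e_def flip: bconst_mult)
  show thesis
    by (rule that[of "e * snd s'" "- (e * snd s)" "e * fst s'" "- (e * fst s)"])
      (use e in \<open>(unfold pencil_member_def bconst_minus bconst_mult bconst_diff, algebra)+\<close>)
qed

text \<open>\<open>P1\<close> holds one representative of each projective point, so distinct
  elements are linearly independent.\<close>

lemma P1_det: "s \<in> P1 \<Longrightarrow> s' \<in> P1 \<Longrightarrow> s \<noteq> s' \<Longrightarrow> fst s * snd s' - fst s' * snd s \<noteq> 0"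
  by (auto simp: P1_def)

text \<open>Two distinct members span the pencil, so a common prime would divide both f and
  g.\<close>

lemma pencil_member_common_factor:
  assumes "coprime f g" "s \<in> P1" "s' \<in> P1" "prime_elem P" "P dvd pencil_member f g s" "P dvd pencil_member f g s'"
  shows "s = s'"
proof (rule ccontr)
  assume "s \<noteq> s'"
  then obtain a b a' b' where "f = bconst a * pencil_member f g s + bconst b * pencil_member f g s'"
    "g = bconst a' * pencil_member f g s + bconst b' * pencil_member f g s'"
    using pencil_member_basis[OF P1_det[OF assms(2,3)]] by metis
  then have "P dvd f" "P dvd g" using assms(5,6) by (metis dvd_add dvd_mult)+
  then show False using prime_not_dvd_coprime assms(1,4) by blast
qed

text \<open>Two members of smaller degree would span f and g and lower both degrees. Hence the line
  at infinity lies in at most one member.\<close>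

lemma pencil_member_degree_drop_unique:
  assumes "s \<in> P1" "s' \<in> P1" "tdeg (pencil_member f g s) < max (tdeg f) (tdeg g)"
    "tdeg (pencil_member f g s') < max (tdeg f) (tdeg g)"
  shows "s = s'"
proof (rule ccontr)
  assume "s \<noteq> s'"
  then obtain a b a' b' where eq: "f = bconst a * pencil_member f g s + bconst b * pencil_member f g s'"
    "g = bconst a' * pencil_member f g s + bconst b' * pencil_member f g s'"
    using pencil_member_basis[OF P1_det[OF assms(1,2)]] by metis
  have "tdeg (bconst c * pencil_member f g s + bconst c' * pencil_member f g s') < max (tdeg f) (tdeg g)" for c c'
    using tdeg_diff_le[of "bconst c * pencil_member f g s" "bconst (- c') * pencil_member f g s'"]
      tdeg_bconst_mult_le[of c "pencil_member f g s"] tdeg_bconst_mult_le[of "- c'" "pencil_member f g s'"] assms(3,4)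
    by (simp add: bconst_minus)
  then have "tdeg f < max (tdeg f) (tdeg g)" "tdeg g < max (tdeg f) (tdeg g)"
    using eq by metis+
  then show False by simp
qed

lemma rho_less:
  assumes AB: "coprime A B" and fg: "coprime f g" "g \<noteq> 0" and nconst: "Fract f g \<notin> range rconst"
    and int: "first_integral A B f g" and gen: "generic_pt A B x y"
  shows "rho f g < lattice_count A B x y + 2"
proof (cases "finite (spectrum2 f g)")
  case False
  then show ?thesis by (simp add: rho_def)
next
  case fin: True
  define \<sigma> where "\<sigma> = spectrum2 f g"
  define d where "d = max (tdeg f) (tdeg g)"
  have \<sigma>: "finite \<sigma>" "\<sigma> \<subseteq> P1" using fin by (auto simp: \<sigma>_def spectrum2_def)
  have f_ne: "f \<noteq> bconst c * g" for c
  proof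
    assume "f = bconst c * g"
    then have "Fract f g = rconst c"
      unfolding rconst_def using fg(2) by (simp add: eq_fract bconst_def)
    then show False using nconst by simp
  qed
  have nz: "pencil_member f g s \<noteq> 0" if "s \<in> P1" for s
    using that f_ne fg(2) by (auto simp: P1_def pencil_member_def)
  have "d > 0"
  proof (rule ccontr)
    assume "\<not> d > 0"
    then obtain a b where ab: "f = bconst a" "g = bconst b"
      using tdeg_eq_0_imp_bconst by (metis d_def max_nat.eq_neutr_iff neq0_conv)
    then have "f = bconst (a / b) * g" using fg(2) by (simp flip: bconst_mult)
    then show False using f_ne by blast
  qed
  have "f \<noteq> 0" using f_ne[of 0] by simp
  \<comment> \<open>Coprimality turns this identity into a common cofactor \<Lambda> of f and g,
    hence of all members.\<close>
  have eq: "deriv2 A B f * g = f * deriv2 A B g" using int by (simp add: first_integral_def)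
  then have "f dvd deriv2 A B f * g" by simp
  then have "f dvd deriv2 A B f" using fg(1) by (simp add: coprime_dvd_mult_left_iff)
  then obtain \<Lambda> where \<Lambda>f: "deriv2 A B f = \<Lambda> * f" by (metis dvdE mult.commute)
  have "f * deriv2 A B g = f * (\<Lambda> * g)" unfolding eq[symmetric] \<Lambda>f by (simp add: mult_ac)
  then have \<Lambda>g: "deriv2 A B g = \<Lambda> * g" using \<open>f \<noteq> 0\<close> by (metis mult_left_cancel)
  have \<Lambda>: "deriv2 A B (pencil_member f g s) = \<Lambda> * pencil_member f g s" for s
    unfolding pencil_member_def deriv2.diff deriv2.scale \<Lambda>f \<Lambda>g by (simp add: algebra_simps)
  have le_d: "tdeg (pencil_member f g s) \<le> d" for s
    unfolding pencil_member_def d_def using tdeg_diff_le[of "bconst (fst s) * f" "bconst (snd s) * g"]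
      tdeg_bconst_mult_le[of "fst s" f] tdeg_bconst_mult_le[of "snd s" g] by simp

  define E where "E = {m. irreducible (f - bconst m * g)}"
  have "infinite E"
  proof
    assume "finite E"
    \<comment> \<open>Outside the finite spectrum and this set of at most one value, a member has
      full degree d > 0 and inherits irreducibility from its homogenization.\<close>
    define Z where "Z = {m. tdeg (pencil_member f g (1, m)) < d}"
    have "m = m'" if "m \<in> Z" "m' \<in> Z" for m m'
      using pencil_member_degree_drop_unique[of "(1, m)" "(1, m')" f g] that by (auto simp: Z_def d_def P1_def)
    then have "finite Z" by (metis finite.emptyI finite.insertI finite_subset insertI1 subsetI)
    moreover have "finite {m. (1, m) \<in> \<sigma>}"
      by (rule finite_subset[OF _ finite_imageI[OF \<sigma>(1), of snd]]) force
    moreover have "UNIV \<subseteq> E \<union> Z \<union> {m. (1, m) \<in> \<sigma>}"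
    proof
      fix m :: complex
      show "m \<in> E \<union> Z \<union> {m. (1, m) \<in> \<sigma>}"
      proof (cases "m \<in> Z \<or> (1, m) \<in> \<sigma>")
        case False
        then have "irreducible (homog d (pencil_member f g (1, m)))" "tdeg (pencil_member f g (1, m)) = d"
          using le_d[of "(1, m)"]
          by (auto simp: \<sigma>_def spectrum2_def P1_def pencil_eq_homog Z_def d_def)
        then have "irreducible (pencil_member f g (1, m))"
          using irreducible_of_irreducible_homog \<open>d > 0\<close> by simp
        then show ?thesis by (simp add: E_def pencil_member_def)
      qed auto
    qed
    ultimately have "finite (UNIV :: complex set)"
      using \<open>finite E\<close> finite_subset by blast
    then show False by (simp add: infinite_UNIV_char_0)
  qed

  define I where "I = (\<lambda>s. prime_factors (pencil_member f g s))"
  \<comment> \<open>For empty \<open>I s\<close> the choice is arbitrary, and removing it changes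
    nothing.\<close>
  define piv where "piv = (\<lambda>s. SOME P. P \<in> I s)"
  define J where "J = (\<Union>s\<in>\<sigma>. I s - {piv s})"
  have I: "prime P" "P dvd pencil_member f g s" if "P \<in> I s" for P s
    using that by (auto simp: I_def in_prime_factors_iff)
  have piv: "piv s \<in> I s" if "P \<in> I s" for P s
    unfolding piv_def using that by (rule someI)
  have I_disj: "s = s'" if "P \<in> I s" "P \<in> I s'" "s \<in> \<sigma>" "s' \<in> \<sigma>" for P s s'
    using pencil_member_common_factor[OF fg(1) _ _ _ I(2)[OF that(1)] I(2)[OF that(2)]]
      I(1)[OF that(1)] that(3,4) \<sigma>(2) by auto
  have finJ: "finite J" using \<sigma>(1) by (simp add: J_def I_def)
  have cardJ: "card J = (\<Sum>s\<in>\<sigma>. card (I s - {piv s}))"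
    unfolding J_def
  proof (rule card_UN_disjoint)
    show "\<forall>s\<in>\<sigma>. \<forall>s'\<in>\<sigma>. s \<noteq> s' \<longrightarrow> (I s - {piv s}) \<inter> (I s' - {piv s'}) = {}"
      using I_disj by blast
  qed (use \<sigma>(1) in \<open>auto simp: I_def\<close>)

  have "card J \<le> lattice_count A B x y"
  proof (rule ccontr)
    assume "\<not> card J \<le> lattice_count A B x y"
    then have less: "lattice_count A B x y < card J" by simp
    define L where "L = (\<lambda>P. deriv2 A B P div P)"
    have L: "prime P" "deriv2 A B P = L P * P" if P: "P \<in> J" for P
    proof -
      obtain s where s: "s \<in> \<sigma>" "P \<in> I s" using P by (auto simp: J_def)
      show "prime P" using I(1)[OF s(2)] .
      have "P dvd deriv2 A B P"
        using deriv2.prime_factor_dvd_derivative[OF _ I(2)[OF s(2)] nz \<Lambda>] I(1)[OF s(2)] s(1) \<sigma>(2) by auto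
      then show "deriv2 A B P = L P * P" by (simp add: L_def)
    qed
    have "P \<noteq> 0 \<and> deriv2 A B P = L P * P" if "P \<in> J" for P
      using L[OF that] by auto
    then obtain c where c: "\<exists>P\<in>J. c P \<noteq> 0" "(\<Sum>P\<in>J. bconst (c P) * L P) = 0"
      using cofactors_dependent[OF finJ less gen] by blast
    have "c P = 0" if "P \<in> J" for P
    proof (rule cofactors_independent[OF AB fg(1) \<Lambda>f \<Lambda>g \<open>infinite E\<close> _ finJ L _ c(2) that])
      fix P assume "P \<in> J"
      then obtain s where s: "s \<in> \<sigma>" "P \<in> I s" by (auto simp: J_def)
      note piv_s = piv[OF s(2)]
      \<comment> \<open>Distinct members share no prime, so a pivot cannot enter \<open>J\<close>
        through another fiber.\<close>
      have "piv s \<notin> J"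
      proof
        assume "piv s \<in> J"
        then obtain s' where "s' \<in> \<sigma>" "piv s \<in> I s' - {piv s'}" by (auto simp: J_def)
        then show False using I_disj[OF piv_s, of s'] s(1) by auto
      qed
      moreover have "fst s \<noteq> 0 \<or> snd s \<noteq> 0" using s(1) \<sigma>(2) by (auto simp: P1_def)
      ultimately show "\<exists>l m r. (l \<noteq> 0 \<or> m \<noteq> 0) \<and> prime r \<and> r \<notin> J \<and>
          P dvd bconst l * f - bconst m * g \<and> r dvd bconst l * f - bconst m * g"
        using I[OF s(2)] I[OF piv_s] unfolding pencil_member_def by blast
    qed (auto simp: E_def)
    then show False using c(1) by blast
  qed

  moreover have "rho f g \<le> card J + 1"
  proof -
    \<comment> \<open>\<open>z s\<close> accounts for the line at infinity, a component when the
      degree drops.\<close>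
    define z :: "complex \<times> complex \<Rightarrow> nat" where "z = (\<lambda>s. if tdeg (pencil_member f g s) < d then 1 else 0)"
    have "n_factors (pencil f g (fst s) (snd s)) - 1 \<le> card (I s - {piv s}) + z s" if "s \<in> \<sigma>" for s
    proof -
      have le: "n_factors (pencil f g (fst s) (snd s)) \<le> card (I s) + z s"
        using n_factors_homog_le[OF nz le_d, of s] that \<sigma>(2)
        by (auto simp: pencil_eq_homog I_def z_def d_def)
      show ?thesis
      proof (cases "I s = {}")
        \<comment> \<open>Without affine factors, at most the line at infinity remains, and the
          summand n - 1 is 0.\<close>
        case True
        then show ?thesis using le by (simp add: z_def split: if_splits)
      next
        case False
        then have "piv s \<in> I s" using piv by blast
        moreover have "finite (I s)" by (simp add: I_def)
        ultimately have "card (I s) = Suc (card (I s - {piv s}))"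
          using card.remove[of "I s" "piv s"] by blast
        then show ?thesis using le by simp
      qed
    qed
    then have "rho f g \<le> (\<Sum>s\<in>\<sigma>. card (I s - {piv s}) + z s)"
      unfolding rho_def \<sigma>_def[symmetric] by (intro sum_mono) (auto split: prod.splits)
    also have "\<dots> = card J + (\<Sum>s\<in>\<sigma>. z s)"
      by (simp add: cardJ sum.distrib)
    also have "(\<Sum>s\<in>\<sigma>. z s) = card {s \<in> \<sigma>. tdeg (pencil_member f g s) < d}"
      using \<sigma>(1) by (simp add: z_def flip: sum.inter_filter)
    also have "\<dots> \<le> 1"
    proof (rule ccontr)
      assume "\<not> ?thesis"
      then obtain s s' where "s \<in> {s \<in> \<sigma>. tdeg (pencil_member f g s) < d}"
        "s' \<in> {s \<in> \<sigma>. tdeg (pencil_member f g s) < d}" "s \<noteq> s'"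
        using card_le_Suc0_iff_eq[of "{s \<in> \<sigma>. tdeg (pencil_member f g s) < d}"] \<sigma>(1) by auto
      then show False
        using pencil_member_degree_drop_unique[of s s' f g] \<sigma>(2) by (auto simp: d_def)
    qed
    finally show ?thesis by simp
  qed
  ultimately show ?thesis by simp
qed

text \<open>A generic point is one off the zero set of a nonzero polynomial, here the product of the
  linear forms whose vanishing means cancellation.\<close>

theorem mainTheorem1:
  fixes A B f g :: "complex poly poly" and k :: nat
  assumes "coprime A B"
    and "tdeg A \<le> k" and "tdeg B \<le> k"
    and "coprime f g" and "g \<noteq> 0"
    and "Fract f g \<notin> range rconst"
    and "\<not> decomposable f g"
    and "first_integral A B f g"
  shows "\<exists>P :: complex poly poly. P \<noteq> 0 \<and>
           (\<forall>x y. eval2 P x y \<noteq> 0 \<longrightarrow> rho f g < lattice_count A B x y + 2)"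
  using exists_generic_polynomial[of A B] rho_less[OF assms(1,4,5,6,8)] by metis

end
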